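(* Let $\psi:N^2\to\mathbb{R}^3:(u,v)\mapsto(u,v,f(u,v))$ be an improper affine sphere with affine normal $(0,0,1)$. Let $\gamma=(\gamma_1,\gamma_2):I\to\mathbb{R}^2$ be a curve such that $$F(t,u,v)=(u,\ v,\ f(u,v)+\gamma_2(t),\ \gamma_1(t))$$ defines a positive definite affine hypersurface of $\mathbb{R}^4$. Then $F$ admits a pointwise $Z_3$- or $SO(2)$-symmetry.
   Context: A nondegenerate affine hypersurface $F:M^3\to\mathbb{R}^4$ is an immersion with (equi)affine (Blaschke) normal field $\xi$, inducing $\nabla$, $h$, $S$ by $D_XY=\nabla_XY+h(X,Y)\xi$, $D_X\xi=-SX$ ($D$ the flat connection of $\mathbb{R}^4$), where $h$ (affine metric) is nondegenerate and $|\det(X_1,X_2,X_3,\xi)|=1$ for $h$-orthonormal $X_1,X_2,X_3$; $S$ is the affine shape operator. The difference tensor is $K(X,Y)=\nabla_XY-\widehat\nabla_XY$ ($\widehat\nabla$ the Levi-Civita connection of $h$). Positive definite means $h$ is positive definite. An improper affine sphere in $\mathbb{R}^3$ is a nondegenerate affine surface whose affine normal is constant. Here $I\subset\mathbb{R}$ is an interval. $F$ admits a pointwise $G$-symmetry ($G=Z_3$ or $SO(2)$) if at every point $p$ there is a subgroup of the orientation-preserving linear isometries of $(T_pM,h)$, consisting of the rotations about some axis by multiples of $2\pi/3$ (for $Z_3$) or by all angles (for $SO(2)$), each element $g$ of which satisfies $K(gX,gY)=gK(X,Y)$ and $S(gX)=gS(X)$ for all $X,Y\in T_pM$. *)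

theory Defs
  imports "HOL-Analysis.Analysis"
begin

text \<open>
  Hypersurfaces are given by parametrizations \<open>F\<close> on an open subset \<open>U\<close> of \<open>\<real>\<^sup>n\<close>.
  Tangent vectors at \<open>p \<in> U\<close> are elements \<open>v\<close> of \<open>\<real>\<^sup>n\<close>, identified with \<open>dF\<^sub>p v\<close>.
\<close>

abbreviation deriv_at ::
  "('a::real_normed_vector \<Rightarrow> 'b::real_normed_vector) \<Rightarrow> 'a \<Rightarrow> 'a \<Rightarrow> 'b" where
  "deriv_at f p v \<equiv> frechet_derivative f (at p) v"

text \<open>\<open>C\<^sup>k\<close> and \<open>C\<^sup>\<infinity>\<close> maps; meant for open \<open>U\<close>.\<close>

primrec Ck_on ::
  "nat \<Rightarrow> 'a::euclidean_space set \<Rightarrow> ('a \<Rightarrow> 'b::real_normed_vector) \<Rightarrow> bool" where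
  "Ck_on 0 U f \<longleftrightarrow> continuous_on U f"
| "Ck_on (Suc k) U f \<longleftrightarrow>
     (\<forall>p\<in>U. f differentiable (at p)) \<and> (\<forall>v. Ck_on k U (\<lambda>p. deriv_at f p v))"

definition smooth_on ::
  "'a::euclidean_space set \<Rightarrow> ('a \<Rightarrow> 'b::real_normed_vector) \<Rightarrow> bool" where
  "smooth_on U f \<longleftrightarrow> (\<forall>k. Ck_on k U f)"

text \<open>
  For a transversal field \<open>\<xi>\<close>, every vector \<open>w\<close> of the ambient space splits uniquely as
  \<open>w = dF\<^sub>p X + c \<xi>\<^sub>p\<close>.
\<close>

definition tangential_part ::
  "(real^'n \<Rightarrow> real^'m) \<Rightarrow> (real^'n \<Rightarrow> real^'m) \<Rightarrow> real^'n \<Rightarrow> real^'m \<Rightarrow> real^'n" where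
  "tangential_part F \<xi> p w = (THE X. \<exists>c. w = deriv_at F p X + c *\<^sub>R \<xi> p)"

definition transversal_part ::
  "(real^'n \<Rightarrow> real^'m) \<Rightarrow> (real^'n \<Rightarrow> real^'m) \<Rightarrow> real^'n \<Rightarrow> real^'m \<Rightarrow> real" where
  "transversal_part F \<xi> p w = (THE c. \<exists>X. w = deriv_at F p X + c *\<^sub>R \<xi> p)"

text \<open>
  \<open>D\<^sub>X Y = \<nabla>\<^sub>X Y + h(X,Y) \<xi>\<close> and \<open>D\<^sub>X \<xi> = - S X\<close>. As \<open>h\<close> is tensorial, \<open>h(v,w)\<close> is computed
  by extending \<open>w\<close> to a constant coefficient (coordinate) field.
\<close>

definition induced_connection ::
  "(real^'n \<Rightarrow> real^'m) \<Rightarrow> (real^'n \<Rightarrow> real^'m) \<Rightarrow>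
   (real^'n \<Rightarrow> real^'n) \<Rightarrow> (real^'n \<Rightarrow> real^'n) \<Rightarrow> real^'n \<Rightarrow> real^'n" where
  "induced_connection F \<xi> X Y p =
     tangential_part F \<xi> p (deriv_at (\<lambda>q. deriv_at F q (Y q)) p (X p))"

definition affine_metric ::
  "(real^'n \<Rightarrow> real^'m) \<Rightarrow> (real^'n \<Rightarrow> real^'m) \<Rightarrow> real^'n \<Rightarrow> real^'n \<Rightarrow> real^'n \<Rightarrow> real" where
  "affine_metric F \<xi> p v w = transversal_part F \<xi> p (deriv_at (\<lambda>q. deriv_at F q w) p v)"

definition shape_operator ::
  "(real^'n \<Rightarrow> real^'m) \<Rightarrow> (real^'n \<Rightarrow> real^'m) \<Rightarrow> real^'n \<Rightarrow> real^'n \<Rightarrow> real^'n" where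
  "shape_operator F \<xi> p v = - tangential_part F \<xi> p (deriv_at \<xi> p v)"

text \<open>
  The Levi-Civita connection of \<open>g\<close> is \<open>\<nabla>\<^sub>X Y = dY(X) + \<Gamma>(X,Y)\<close>, with \<open>\<Gamma>\<^sub>p\<close> the unique bilinear map
  making it torsion free (\<open>\<Gamma>\<close> symmetric) and metric (\<open>\<nabla>g = 0\<close>, tested on coordinate fields).
\<close>

definition christoffel ::
  "(real^'n \<Rightarrow> real^'n \<Rightarrow> real^'n \<Rightarrow> real) \<Rightarrow> real^'n \<Rightarrow> real^'n \<Rightarrow> real^'n \<Rightarrow> real^'n" where
  "christoffel g p = (THE \<Gamma>. bilinear \<Gamma> \<and> (\<forall>u v. \<Gamma> u v = \<Gamma> v u) \<and>
     (\<forall>u v w. deriv_at (\<lambda>q. g q v w) p u = g p (\<Gamma> u v) w + g p v (\<Gamma> u w)))"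

definition levi_civita ::
  "(real^'n \<Rightarrow> real^'n \<Rightarrow> real^'n \<Rightarrow> real) \<Rightarrow>
   (real^'n \<Rightarrow> real^'n) \<Rightarrow> (real^'n \<Rightarrow> real^'n) \<Rightarrow> real^'n \<Rightarrow> real^'n" where
  "levi_civita g X Y p = deriv_at Y p (X p) + christoffel g p (X p) (Y p)"

text \<open>\<open>K\<close>, the induced minus the Levi-Civita connection, is a tensor, hence evaluated on constant coefficient fields.\<close>

definition difference_tensor ::
  "(real^'n \<Rightarrow> real^'m) \<Rightarrow> (real^'n \<Rightarrow> real^'m) \<Rightarrow> real^'n \<Rightarrow> real^'n \<Rightarrow> real^'n \<Rightarrow> real^'n" where
  "difference_tensor F \<xi> p v w =
     induced_connection F \<xi> (\<lambda>_. v) (\<lambda>_. w) p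
     - levi_civita (affine_metric F \<xi>) (\<lambda>_. v) (\<lambda>_. w) p"

text \<open>Orthonormal bases of a possibly indefinite form on \<open>\<real>\<^sup>n\<close>: \<open>g(X\<^sub>i,X\<^sub>j) = \<plusminus>\<delta>\<^sub>i\<^sub>j\<close>.\<close>

definition orthonormal_frame ::
  "(real^'n \<Rightarrow> real^'n \<Rightarrow> real) \<Rightarrow> (real^'n) list \<Rightarrow> bool" where
  "orthonormal_frame g Xs \<longleftrightarrow> length Xs = CARD('n) \<and>
     (\<forall>i<length Xs. \<bar>g (Xs ! i) (Xs ! i)\<bar> = 1) \<and>
     (\<forall>i<length Xs. \<forall>j<length Xs. i \<noteq> j \<longrightarrow> g (Xs ! i) (Xs ! j) = 0)"

text \<open>
  \<open>F\<close> is a nondegenerate affine hypersurface on \<open>U\<close> with affine (Blaschke) normal field \<open>\<xi>\<close>.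
  The list in the last clause is \<open>X\<^sub>1, \<dots>, X\<^sub>n, \<xi>\<close>; the index type \<open>'m\<close> is meant to be a numeral type.
\<close>

definition blaschke_hypersurface ::
  "(real^'n) set \<Rightarrow> (real^'n \<Rightarrow> real^'m::{finite,one,plus}) \<Rightarrow> (real^'n \<Rightarrow> real^'m::{finite,one,plus}) \<Rightarrow> bool" where
  "blaschke_hypersurface U F \<xi> \<longleftrightarrow>
     CARD('m) = CARD('n) + 1 \<and> open U \<and> smooth_on U F \<and> smooth_on U \<xi> \<and>
     (\<forall>p\<in>U.
        inj (deriv_at F p) \<and>
        \<xi> p \<notin> range (deriv_at F p) \<and>
        (\<forall>v. deriv_at \<xi> p v \<in> range (deriv_at F p)) \<and>
        (\<forall>v. (\<forall>w. affine_metric F \<xi> p v w = 0) \<longrightarrow> v = 0) \<and>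
        (\<forall>Xs. orthonormal_frame (affine_metric F \<xi> p) Xs \<longrightarrow>
           \<bar>det (vector (map (deriv_at F p) Xs @ [\<xi> p]))\<bar> = 1))"

definition positive_definite_hypersurface ::
  "(real^'n) set \<Rightarrow> (real^'n \<Rightarrow> real^'m::{finite,one,plus}) \<Rightarrow> (real^'n \<Rightarrow> real^'m::{finite,one,plus}) \<Rightarrow> bool" where
  "positive_definite_hypersurface U F \<xi> \<longleftrightarrow>
     blaschke_hypersurface U F \<xi> \<and> (\<forall>p\<in>U. \<forall>v. v \<noteq> 0 \<longrightarrow> affine_metric F \<xi> p v v > 0)"

definition improper_affine_sphere ::
  "(real^2) set \<Rightarrow> (real^2 \<Rightarrow> real^3) \<Rightarrow> real^3 \<Rightarrow> bool" where
  "improper_affine_sphere U \<psi> c \<longleftrightarrow> blaschke_hypersurface U \<psi> (\<lambda>_. c)"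

definition orientation_preserving_isometries ::
  "(real^3 \<Rightarrow> real^3 \<Rightarrow> real) \<Rightarrow> (real^3 \<Rightarrow> real^3) set" where
  "orientation_preserving_isometries g =
     {A. linear A \<and> (\<forall>v w. g (A v) (A w) = g v w) \<and> det (matrix A) > 0}"

text \<open>
  Rotations of \<open>(\<real>\<^sup>3, g)\<close> about the axis \<open>e\<^sub>1\<close> by the angles in \<open>\<Theta>\<close>; \<open>e\<^sub>1, e\<^sub>2, e\<^sub>3\<close> is meant to be
  a \<open>g\<close>-orthonormal basis.
\<close>

definition rotations ::
  "(real^3 \<Rightarrow> real^3 \<Rightarrow> real) \<Rightarrow> real^3 \<Rightarrow> real^3 \<Rightarrow> real^3 \<Rightarrow> real set \<Rightarrow> (real^3 \<Rightarrow> real^3) set" where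
  "rotations g e1 e2 e3 \<Theta> = {A \<in> orientation_preserving_isometries g. \<exists>\<theta>\<in>\<Theta>.
     A e1 = e1 \<and>
     A e2 = cos \<theta> *\<^sub>R e2 + sin \<theta> *\<^sub>R e3 \<and>
     A e3 = - sin \<theta> *\<^sub>R e2 + cos \<theta> *\<^sub>R e3}"

definition pointwise_symmetry ::
  "real set \<Rightarrow> (real^3) set \<Rightarrow> (real^3 \<Rightarrow> real^4) \<Rightarrow> (real^3 \<Rightarrow> real^4) \<Rightarrow> bool" where
  "pointwise_symmetry \<Theta> U F \<xi> \<longleftrightarrow>
     (\<forall>p\<in>U. \<exists>e1 e2 e3. orthonormal_frame (affine_metric F \<xi> p) [e1, e2, e3] \<and>
        (\<forall>A \<in> rotations (affine_metric F \<xi> p) e1 e2 e3 \<Theta>.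
           (\<forall>v w. difference_tensor F \<xi> p (A v) (A w) = A (difference_tensor F \<xi> p v w)) \<and>
           (\<forall>v. shape_operator F \<xi> p (A v) = A (shape_operator F \<xi> p v))))"

definition pointwise_Z3_symmetry ::
  "(real^3) set \<Rightarrow> (real^3 \<Rightarrow> real^4) \<Rightarrow> (real^3 \<Rightarrow> real^4) \<Rightarrow> bool" where
  "pointwise_Z3_symmetry = pointwise_symmetry {of_int k * (2 * pi / 3) | k. True}"

definition pointwise_SO2_symmetry ::
  "(real^3) set \<Rightarrow> (real^3 \<Rightarrow> real^4) \<Rightarrow> (real^3 \<Rightarrow> real^4) \<Rightarrow> bool" where
  "pointwise_SO2_symmetry = pointwise_symmetry UNIV"

end

theory Submission
  imports Defs
begin

text \<open>
  With \<open>\<kappa> = \<gamma>\<^sub>1' \<gamma>\<^sub>2'' - \<gamma>\<^sub>2' \<gamma>\<^sub>1''\<close> and a conormal \<open>\<nu>\<close> normalized by \<open>\<nu>(0,0,1,0) = \<gamma>\<^sub>1'\<close>, the affine metric is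
  \<open>h = (\<gamma>\<^sub>1' Hess f + \<kappa> dt\<^sup>2) / \<rho>\<close> with \<open>\<rho> = \<nu>(\<xi>)\<close>. As \<open>\<psi>\<close> is an improper affine sphere,
  \<open>det Hess f\<close> is constant, and the volume normalization of \<open>\<xi>\<close> becomes
  \<open>\<rho>\<^sup>5 = \<kappa> (\<gamma>\<^sub>1')\<^sup>2\<close>, so \<open>\<rho>\<close> depends on \<open>t\<close> only. This forces \<open>\<xi>\<close> to be a curve in the plane
  of the last two coordinates; hence \<open>S\<close> is a multiple of the projection to \<open>\<partial>\<^sub>t\<close>. All terms of \<open>K\<close> are
  invariant under every rotation about \<open>\<partial>\<^sub>t\<close>, except the one dual to the cubic form \<open>D\<^sup>3 f\<close>. That form is
  trace free, because \<open>det Hess f\<close> is constant, so in an orthonormal frame it is the real part of a complex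
  multiple of \<open>z\<^sup>3\<close>, which is invariant under rotation by \<open>2\<pi>/3\<close>.
\<close>

subsection \<open>Calculus\<close>

lemma has_derivative_deriv_at:
  "f differentiable (at p) \<Longrightarrow> (f has_derivative deriv_at f p) (at p)"
  by (simp add: frechet_derivative_works)

lemma deriv_at_eq: "(f has_derivative f') (at p) \<Longrightarrow> deriv_at f p = f'"
  by (metis frechet_derivative_at)

text \<open>On an open set the derivative at a point sees only nearby values. The induction varies
  both functions because it passes to their directional derivatives.\<close>

lemma Ck_on_cong:
  assumes "open U" "\<And>x. x \<in> U \<Longrightarrow> f x = g x" "Ck_on k U f"
  shows "Ck_on k U g"
  using assms(2,3)
proof (induction k arbitrary: f g)
  case 0
  then show ?case
    using continuous_on_cong[of U U f g] by simp
next
  case (Suc k)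
  have der: "(g has_derivative deriv_at f p) (at p)" if "p \<in> U" for p
    using Suc.prems that has_derivative_transform_within_open[OF has_derivative_deriv_at assms(1) that]
    by auto
  have "Ck_on k U (\<lambda>p. deriv_at g p v)" for v
    using Suc.IH[of "\<lambda>p. deriv_at f p v" "\<lambda>p. deriv_at g p v"] Suc.prems deriv_at_eq[OF der] by simp
  with der show ?case
    by (auto simp: differentiable_def)
qed

lemma Ck_on_bounded_linear:
  assumes "open U" "bounded_linear L" "Ck_on k U f"
  shows "Ck_on k U (\<lambda>x. L (f x))"
  using assms(3)
proof (induction k arbitrary: f)
  case 0
  then show ?case
    using bounded_linear.continuous_on[OF assms(2)] by simp
next
  case (Suc k)
  have der: "((\<lambda>x. L (f x)) has_derivative (\<lambda>v. L (deriv_at f p v))) (at p)" if "p \<in> U" for p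
    using Suc.prems that bounded_linear.has_derivative[OF assms(2) has_derivative_deriv_at] by auto
  have "Ck_on k U (\<lambda>p. deriv_at (\<lambda>x. L (f x)) p v)" for v
    using Ck_on_cong[OF assms(1), of "\<lambda>p. L (deriv_at f p v)"] Suc deriv_at_eq[OF der] by simp
  with der show ?case
    by (auto simp: differentiable_def)
qed

lemma smooth_on_bounded_linear:
  "open U \<Longrightarrow> bounded_linear L \<Longrightarrow> smooth_on U f \<Longrightarrow> smooth_on U (\<lambda>x. L (f x))"
  by (simp add: smooth_on_def Ck_on_bounded_linear)

lemma smooth_on_deriv: "smooth_on U f \<Longrightarrow> smooth_on U (\<lambda>p. deriv_at f p v)"
  unfolding smooth_on_def by (metis Ck_on.simps(2))

lemma smooth_on_imp_differentiable: "smooth_on U f \<Longrightarrow> p \<in> U \<Longrightarrow> f differentiable (at p)"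
  unfolding smooth_on_def by (metis Ck_on.simps(2))

lemma smooth_on_has_derivative:
  "smooth_on U f \<Longrightarrow> p \<in> U \<Longrightarrow> (f has_derivative deriv_at f p) (at p)"
  by (simp add: smooth_on_imp_differentiable has_derivative_deriv_at)

lemma smooth_on_imp_continuous_on: "smooth_on U f \<Longrightarrow> continuous_on U f"
  unfolding smooth_on_def by (metis Ck_on.simps(1))

lemma has_derivative_along_line:
  fixes f :: "'a::real_normed_vector \<Rightarrow> real"
  assumes "(f has_derivative f') (at (p + r *\<^sub>R v))"
  shows "((\<lambda>r. f (p + r *\<^sub>R v)) has_real_derivative f' v) (at r)"
proof -
  have "((\<lambda>r. f (p + r *\<^sub>R v)) has_derivative (\<lambda>s. f' (s *\<^sub>R v))) (at r)"
    by (rule has_derivative_compose[where f = "\<lambda>r. p + r *\<^sub>R v" and g = f])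
      (auto intro!: derivative_eq_intros assms)
  moreover have "f' (s *\<^sub>R v) = f' v * s" for s
    using assms has_derivative_linear linear_cmul by fastforce
  ultimately show ?thesis
    by (simp add: has_field_derivative_def)
qed

section \<open>Symmetry of second and third derivatives\<close>

definition hessian :: "('a::real_normed_vector \<Rightarrow> real) \<Rightarrow> 'a \<Rightarrow> 'a \<Rightarrow> 'a \<Rightarrow> real" where
  "hessian f p v w = deriv_at (\<lambda>q. deriv_at f q w) p v"

definition third_derivative :: "('a::real_normed_vector \<Rightarrow> real) \<Rightarrow> 'a \<Rightarrow> 'a \<Rightarrow> 'a \<Rightarrow> 'a \<Rightarrow> real" where
  "third_derivative f p u v w = deriv_at (\<lambda>q. hessian f q v w) p u"

text \<open>The mean value theorem is applied twice, first in direction v and then in direction w.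
  The left side is symmetric in v and w, so exchanging them yields the other mixed
  derivative.\<close>

lemma second_difference_mvt:
  fixes f :: "'a::euclidean_space \<Rightarrow> real"
  assumes f: "smooth_on U f" and "s > 0"
    and U: "\<And>a b. 0 \<le> a \<Longrightarrow> a \<le> s \<Longrightarrow> 0 \<le> b \<Longrightarrow> b \<le> s \<Longrightarrow> p + a *\<^sub>R v + b *\<^sub>R w \<in> U"
  shows "\<exists>a b. 0 < a \<and> a < s \<and> 0 < b \<and> b < s \<and>
    f (p + s *\<^sub>R v + s *\<^sub>R w) - f (p + s *\<^sub>R v) - f (p + s *\<^sub>R w) + f p
      = s\<^sup>2 * hessian f (p + a *\<^sub>R v + b *\<^sub>R w) w v"
proof -
  have line: "((\<lambda>a. f (p + a *\<^sub>R v + b *\<^sub>R w)) has_real_derivative deriv_at f (p + a *\<^sub>R v + b *\<^sub>R w) v) (at a)"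
    if "0 \<le> a" "a \<le> s" "0 \<le> b" "b \<le> s" for a b
    using has_derivative_along_line[of f _ "p + b *\<^sub>R w" a v] smooth_on_has_derivative[OF f U[OF that]]
    by (simp add: algebra_simps)
  \<comment> \<open>The summand \<open>0 *\<^sub>R w\<close> lets \<open>line\<close> apply to both
    terms, at b = s and at b = 0.\<close>
  define \<phi> where "\<phi> a = f (p + a *\<^sub>R v + s *\<^sub>R w) - f (p + a *\<^sub>R v + 0 *\<^sub>R w)" for a
  have "(\<phi> has_real_derivative
      deriv_at f (p + a *\<^sub>R v + s *\<^sub>R w) v - deriv_at f (p + a *\<^sub>R v + 0 *\<^sub>R w) v) (at a)"
    if "0 \<le> a" "a \<le> s" for a
    unfolding \<phi>_def using that \<open>s > 0\<close> by (intro DERIV_diff line) auto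
  from MVT2[OF \<open>s > 0\<close> this] obtain a where a: "0 < a" "a < s" and eq1:
    "f (p + s *\<^sub>R v + s *\<^sub>R w) - f (p + s *\<^sub>R v) - f (p + s *\<^sub>R w) + f p
      = s * (deriv_at f (p + a *\<^sub>R v + s *\<^sub>R w) v - deriv_at f (p + a *\<^sub>R v) v)"
    by (auto simp: \<phi>_def algebra_simps)
  have "((\<lambda>b. deriv_at f (p + a *\<^sub>R v + b *\<^sub>R w) v) has_real_derivative
      hessian f (p + a *\<^sub>R v + b *\<^sub>R w) w v) (at b)" if "0 \<le> b" "b \<le> s" for b
    unfolding hessian_def
    by (rule has_derivative_along_line[OF smooth_on_has_derivative[OF smooth_on_deriv[OF f] U]])
      (use a that in auto)
  from MVT2[OF \<open>s > 0\<close> this] obtain b where b: "0 < b" "b < s"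
      "deriv_at f (p + a *\<^sub>R v + s *\<^sub>R w) v - deriv_at f (p + a *\<^sub>R v) v
      = s * hessian f (p + a *\<^sub>R v + b *\<^sub>R w) w v"
    by auto
  then show ?thesis
    using a b eq1 by (auto simp: power2_eq_square)
qed

text \<open>Schwarz's theorem: the same second difference equals a value of either mixed derivative
  at points arbitrarily close to p, so by continuity the two cannot differ at p.\<close>

lemma hessian_commute:
  fixes f :: "'a::euclidean_space \<Rightarrow> real"
  assumes "open U" and f: "smooth_on U f" and "p \<in> U"
  shows "hessian f p v w = hessian f p w v"
proof (rule ccontr)
  assume neq: "hessian f p v w \<noteq> hessian f p w v"
  \<comment> \<open>Half the gap: two values that lie within \<open>e\<close> of the respective
    limits cannot coincide.\<close>
  define e where "e = \<bar>hessian f p v w - hessian f p w v\<bar> / 2"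
  have "e > 0"
    using neq by (simp add: e_def)
  have cont: "isCont (\<lambda>q. hessian f q x y) p" for x y
    using smooth_on_imp_continuous_on[OF smooth_on_deriv[OF smooth_on_deriv[OF f]]] assms
    by (simp add: hessian_def continuous_on_eq_continuous_at)
  obtain d1 where d1: "d1 > 0" "\<And>q. dist q p < d1 \<Longrightarrow> dist (hessian f q v w) (hessian f p v w) < e"
    using cont[of v w] \<open>e > 0\<close> unfolding continuous_at_eps_delta by blast
  obtain d2 where d2: "d2 > 0" "\<And>q. dist q p < d2 \<Longrightarrow> dist (hessian f q w v) (hessian f p w v) < e"
    using cont[of w v] \<open>e > 0\<close> unfolding continuous_at_eps_delta by blast
  obtain d3 where d3: "d3 > 0" "ball p d3 \<subseteq> U"
    using assms open_contains_ball by blast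
  define d where "d = min d1 (min d2 d3)"
  \<comment> \<open>Small enough that the parallelogram with sides s v and s w stays within distance
    d of p; the summand 1 covers v = w = 0.\<close>
  define s where "s = d / (2 * (norm v + norm w + 1))"
  have pos: "norm v + norm w + 1 > 0"
    by (simp add: add_nonneg_pos)
  have "d > 0" "s > 0"
    using d1 d2 d3 pos by (auto simp: d_def s_def)
  have near: "norm (a *\<^sub>R v + b *\<^sub>R w) < d" if "0 \<le> a" "a \<le> s" "0 \<le> b" "b \<le> s" for a b
  proof -
    have "norm (a *\<^sub>R v + b *\<^sub>R w) \<le> a * norm v + b * norm w"
      using that norm_triangle_ineq[of "a *\<^sub>R v" "b *\<^sub>R w"] by simp
    also have "\<dots> \<le> s * norm v + s * norm w"
      using that by (intro add_mono mult_right_mono) auto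
    also have "\<dots> < s * (2 * (norm v + norm w + 1))"
      using \<open>s > 0\<close> by (simp add: algebra_simps add_nonneg_pos add_pos_nonneg)
    also have "\<dots> = d"
      using pos by (simp add: s_def)
    finally show ?thesis .
  qed
  have U: "p + a *\<^sub>R v + b *\<^sub>R w \<in> U" if "0 \<le> a" "a \<le> s" "0 \<le> b" "b \<le> s" for a b
  proof -
    have "p + (a *\<^sub>R v + b *\<^sub>R w) \<in> ball p d3"
      using near[OF that] norm_minus_cancel[of "a *\<^sub>R v + b *\<^sub>R w"]
      by (simp add: d_def dist_norm)
    then show ?thesis
      using d3 by (auto simp: add.assoc)
  qed
  have U': "p + a *\<^sub>R w + b *\<^sub>R v \<in> U" if "0 \<le> a" "a \<le> s" "0 \<le> b" "b \<le> s" for a b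
    using U[of b a] that by (simp add: add_ac)
  obtain a b where ab: "0 < a" "a < s" "0 < b" "b < s"
    "f (p + s *\<^sub>R v + s *\<^sub>R w) - f (p + s *\<^sub>R v) - f (p + s *\<^sub>R w) + f p
      = s\<^sup>2 * hessian f (p + a *\<^sub>R v + b *\<^sub>R w) w v"
    using second_difference_mvt[OF f \<open>s > 0\<close> U] by (auto simp: add_ac)
  obtain a' b' where ab': "0 < a'" "a' < s" "0 < b'" "b' < s"
    "f (p + s *\<^sub>R w + s *\<^sub>R v) - f (p + s *\<^sub>R w) - f (p + s *\<^sub>R v) + f p
      = s\<^sup>2 * hessian f (p + a' *\<^sub>R w + b' *\<^sub>R v) v w"
    using second_difference_mvt[OF f \<open>s > 0\<close> U'] by (auto simp: add_ac)
  have "s\<^sup>2 * hessian f (p + a *\<^sub>R v + b *\<^sub>R w) w v = s\<^sup>2 * hessian f (p + a' *\<^sub>R w + b' *\<^sub>R v) v w"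
    using ab(5) ab'(5) unfolding add.assoc add.commute[of "s *\<^sub>R w" "s *\<^sub>R v"] by linarith
  then have "hessian f (p + a *\<^sub>R v + b *\<^sub>R w) w v = hessian f (p + a' *\<^sub>R w + b' *\<^sub>R v) v w"
    using \<open>s > 0\<close> by simp
  moreover have "dist (p + a *\<^sub>R v + b *\<^sub>R w) p < d2"
    using near[of a b] ab by (simp add: dist_norm add.assoc d_def)
  moreover have "dist (p + a' *\<^sub>R w + b' *\<^sub>R v) p < d1"
    using near[of b' a'] ab' by (simp add: dist_norm add.assoc d_def add.commute)
  ultimately show False
    using d1(2) d2(2) unfolding e_def dist_real_def by (smt (verit) field_sum_of_halves)
qed

lemma hessian_has_derivative:
  assumes "smooth_on U f" "p \<in> U"
  shows "((\<lambda>q. deriv_at f q w) has_derivative (\<lambda>v. hessian f p v w)) (at p)"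
  unfolding hessian_def by (rule smooth_on_has_derivative[OF smooth_on_deriv]) fact+

lemma third_has_derivative:
  assumes "smooth_on U f" "p \<in> U"
  shows "((\<lambda>q. hessian f q v w) has_derivative (\<lambda>u. third_derivative f p u v w)) (at p)"
  unfolding third_derivative_def hessian_def
  by (rule smooth_on_has_derivative[OF smooth_on_deriv[OF smooth_on_deriv]]) fact+

text \<open>This is the symmetry of the Hessian of the directional derivative of f along w.\<close>

lemma third_commute_left:
  fixes f :: "'a::euclidean_space \<Rightarrow> real"
  assumes "open U" "smooth_on U f" "p \<in> U"
  shows "third_derivative f p u v w = third_derivative f p v u w"
  using hessian_commute[OF assms(1) smooth_on_deriv[OF assms(2)] assms(3)]
  by (simp add: third_derivative_def hessian_def)

text \<open>Here the symmetry of the Hessian itself is differentiated. The two transpositions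
  together give full symmetry.\<close>

lemma third_commute_right:
  fixes f :: "'a::euclidean_space \<Rightarrow> real"
  assumes "open U" "smooth_on U f" "p \<in> U"
  shows "third_derivative f p u v w = third_derivative f p u w v"
proof -
  have "((\<lambda>q. hessian f q v w) has_derivative (\<lambda>u. third_derivative f p u w v)) (at p)"
    by (rule has_derivative_transform_within_open[OF third_has_derivative[OF assms(2,3), of w v] assms(1,3)])
      (rule hessian_commute[OF assms(1,2)])
  then show ?thesis
    by (simp add: third_derivative_def deriv_at_eq)
qed

lemma hessian_bilinear:
  fixes f :: "'a::euclidean_space \<Rightarrow> real"
  assumes "open U" "smooth_on U f" "p \<in> U"
  shows "bilinear (hessian f p)"
proof -
  have "linear (\<lambda>v. hessian f p v w)" for w
    using hessian_has_derivative[OF assms(2,3)] by (rule has_derivative_linear)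
  then show ?thesis
    by (simp add: bilinear_def hessian_commute[OF assms])
qed

lemma third_linear:
  assumes "smooth_on U f" "p \<in> U"
  shows "linear (\<lambda>u. third_derivative f p u v w)"
  using third_has_derivative[OF assms] by (rule has_derivative_linear)

text \<open>Transversality makes c unique and injectivity then makes X unique. Both definite
  descriptions can thus be evaluated by exhibiting one splitting.\<close>

lemma transversal_tangential_eqI:
  assumes "linear (deriv_at F p)" "inj (deriv_at F p)" "\<xi> p \<notin> range (deriv_at F p)"
    and w: "w = deriv_at F p X + c *\<^sub>R \<xi> p"
  shows "transversal_part F \<xi> p w = c" "tangential_part F \<xi> p w = X"
proof -
  have uniq: "X' = X \<and> c' = c" if "w = deriv_at F p X' + c' *\<^sub>R \<xi> p" for X' c'
  proof -
    have eq: "(c' - c) *\<^sub>R \<xi> p = deriv_at F p (X - X')"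
      unfolding linear_diff[OF assms(1)] using trans[OF w[symmetric] that] by (simp add: algebra_simps)
    have "c' = c"
    proof (rule ccontr)
      assume "c' \<noteq> c"
      then have "\<xi> p = deriv_at F p ((1 / (c' - c)) *\<^sub>R (X - X'))"
        using linear_cmul[OF assms(1)] eq[symmetric] by simp
      then show False
        using assms(3) by blast
    qed
    then show ?thesis
      using w that assms(2) by (simp add: inj_eq)
  qed
  show "transversal_part F \<xi> p w = c" "tangential_part F \<xi> p w = X"
    unfolding transversal_part_def tangential_part_def using w uniq by (blast intro: the_equality)+
qed

text \<open>Uniqueness of the Levi-Civita connection: the difference of two candidates, lowered with
  g, is symmetric in its first two and skew in its last two arguments, hence zero.\<close>

lemma christoffel_eqI:
  fixes g :: "real^'n \<Rightarrow> real^'n \<Rightarrow> real^'n \<Rightarrow> real"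
  assumes bil: "bilinear (g p)" and sym: "\<And>v w. g p v w = g p w v"
    and nondeg: "\<And>v. (\<And>w. g p v w = 0) \<Longrightarrow> v = 0"
    and G: "bilinear \<Gamma>" "\<And>u v. \<Gamma> u v = \<Gamma> v u"
      "\<And>u v w. deriv_at (\<lambda>q. g q v w) p u = g p (\<Gamma> u v) w + g p v (\<Gamma> u w)"
  shows "christoffel g p = \<Gamma>"
  unfolding christoffel_def
proof (rule the_equality)
  fix \<Delta>
  assume D: "bilinear \<Delta> \<and> (\<forall>u v. \<Delta> u v = \<Delta> v u) \<and>
     (\<forall>u v w. deriv_at (\<lambda>q. g q v w) p u = g p (\<Delta> u v) w + g p v (\<Delta> u w))"
  define T where "T u v w = g p (\<Delta> u v - \<Gamma> u v) w" for u v w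
  have T_eq: "T u v w = g p (\<Delta> u v) w - g p (\<Gamma> u v) w" for u v w
    unfolding T_def using bilinear_lsub[OF bil] .
  have skew: "T u v w = - T u w v" for u v w
  proof -
    have "g p (\<Gamma> u v) w + g p v (\<Gamma> u w) = g p (\<Delta> u v) w + g p v (\<Delta> u w)"
      using D G(3)[of v w u] by simp
    then show ?thesis
      by (simp add: T_eq sym[of v])
  qed
  have symT: "T u v w = T v u w" for u v w
    using D G(2) by (simp add: T_def)
  \<comment> \<open>Alternating the two rules gives T u v w = - T u w v = - T w u v = T w v u = T v
    w u = - T v u w = - T u v w.\<close>
  have "T u v w = 0" for u v w
    using skew[of u v w] symT[of u w v] skew[of w u v] symT[of w v u] skew[of v w u] symT[of v u w]
    by linarith
  then have "\<Delta> u v = \<Gamma> u v" for u v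
    using nondeg[of "\<Delta> u v - \<Gamma> u v"] by (simp add: T_def)
  then show "\<Delta> = \<Gamma>"
    by blast
qed (use G in auto)

section \<open>Explicit linear algebra in low dimension, and derivatives along lines\<close>

lemma vector_4 [simp]:
  "(vector [x, y, z, w] :: 'a::zero^4) $ 1 = x"
  "(vector [x, y, z, w] :: 'a::zero^4) $ 2 = y"
  "(vector [x, y, z, w] :: 'a::zero^4) $ 3 = z"
  "(vector [x, y, z, w] :: 'a::zero^4) $ 4 = w"
  unfolding vector_def by simp_all

text \<open>Laplace expansion along the first row; the sum over permutations is peeled off one index
  at a time.\<close>

lemma det_4:
  "det (A::'a::comm_ring_1^4^4) =
    A$1$1 * (A$2$2 * (A$3$3 * A$4$4 - A$3$4 * A$4$3) - A$2$3 * (A$3$2 * A$4$4 - A$3$4 * A$4$2)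
           + A$2$4 * (A$3$2 * A$4$3 - A$3$3 * A$4$2))
  - A$1$2 * (A$2$1 * (A$3$3 * A$4$4 - A$3$4 * A$4$3) - A$2$3 * (A$3$1 * A$4$4 - A$3$4 * A$4$1)
           + A$2$4 * (A$3$1 * A$4$3 - A$3$3 * A$4$1))
  + A$1$3 * (A$2$1 * (A$3$2 * A$4$4 - A$3$4 * A$4$2) - A$2$2 * (A$3$1 * A$4$4 - A$3$4 * A$4$1)
           + A$2$4 * (A$3$1 * A$4$2 - A$3$2 * A$4$1))
  - A$1$4 * (A$2$1 * (A$3$2 * A$4$3 - A$3$3 * A$4$2) - A$2$2 * (A$3$1 * A$4$3 - A$3$3 * A$4$1)
           + A$2$3 * (A$3$1 * A$4$2 - A$3$2 * A$4$1))"
proof -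
  have f1234: "finite {2::4, 3, 4}" "1 \<notin> {2::4, 3, 4}"
    by auto
  have f234: "finite {3::4, 4}" "2 \<notin> {3::4, 4}"
    by auto
  have f34: "finite {4::4}" "3 \<notin> {4::4}"
    by auto
  show ?thesis
    unfolding det_def UNIV_4
    unfolding sum_over_permutations_insert[OF f1234]
    unfolding sum_over_permutations_insert[OF f234]
    unfolding sum_over_permutations_insert[OF f34]
    unfolding permutes_sing
    by (simp add: sign_swap_id permutation_swap_id permutation_compose sign_compose sign_id
        swap_id_eq algebra_simps)
qed

lemma has_derivative_vector_3:
  assumes "(a has_derivative a') (at x)" "(b has_derivative b') (at x)" "(c has_derivative c') (at x)"
  shows "((\<lambda>x. vector [a x, b x, c x] :: real^3) has_derivative (\<lambda>v. vector [a' v, b' v, c' v])) (at x)"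
proof -
  have "((\<lambda>x. (vector [a x, b x, c x] :: real^3) $ i) has_derivative
    (\<lambda>v. (vector [a' v, b' v, c' v] :: real^3) $ i)) (at x)" for i
    using exhaust_3[of i] assms by auto
  then show ?thesis
    by (subst has_derivative_componentwise_within) (auto simp: Basis_vec_def inner_axis)
qed

lemma has_derivative_vector_4:
  assumes "(a has_derivative a') (at x)" "(b has_derivative b') (at x)"
    "(c has_derivative c') (at x)" "(d has_derivative d') (at x)"
  shows "((\<lambda>x. vector [a x, b x, c x, d x] :: real^4) has_derivative
    (\<lambda>v. vector [a' v, b' v, c' v, d' v])) (at x)"
proof -
  have "((\<lambda>x. (vector [a x, b x, c x, d x] :: real^4) $ i) has_derivative
    (\<lambda>v. (vector [a' v, b' v, c' v, d' v] :: real^4) $ i)) (at x)" for i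
    using exhaust_4[of i] assms by auto
  then show ?thesis
    by (subst has_derivative_componentwise_within) (auto simp: Basis_vec_def inner_axis)
qed

text \<open>With z = x + i y and \<omega> = co + i si, A multiplies z by \<omega>, and G(v,w) has
  the complex coordinate conj((P + i Q) z(v) z(w)). Rotating v and w therefore multiplies G by
  conj(\<omega>^2), which is \<omega> by \<open>double\<close>.\<close>

lemma rotation_cubic_equivariant:
  fixes A :: "'a::real_vector \<Rightarrow> 'a" and x y :: "'a \<Rightarrow> real"
  assumes "linear A" and A: "A e = co *\<^sub>R e + si *\<^sub>R e'" "A e' = - si *\<^sub>R e + co *\<^sub>R e'"
    and xA: "\<And>v. x (A v) = co * x v - si * y v" and yA: "\<And>v. y (A v) = si * x v + co * y v"
    and double: "co\<^sup>2 - si\<^sup>2 = co" "2 * co * si = - si"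
    and G: "\<And>v w. G v w = (P * (x v * x w - y v * y w) - Q * (x v * y w + y v * x w)) *\<^sub>R e
      - (P * (x v * y w + y v * x w) + Q * (x v * x w - y v * y w)) *\<^sub>R e'"
  shows "G (A v) (A w) = A (G v w)"
proof -
  \<comment> \<open>Real and imaginary part of z(v) z(w).\<close>
  define m n where "m = x v * x w - y v * y w" and "n = x v * y w + y v * x w"
  have "x (A v) * x (A w) - y (A v) * y (A w) = (co\<^sup>2 - si\<^sup>2) * m - (2 * co * si) * n"
    "x (A v) * y (A w) + y (A v) * x (A w) = (2 * co * si) * m + (co\<^sup>2 - si\<^sup>2) * n"
    unfolding xA yA m_def n_def by algebra+
  then have m': "x (A v) * x (A w) - y (A v) * y (A w) = co * m + si * n"
    and n': "x (A v) * y (A w) + y (A v) * x (A w) = co * n - si * m"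
    unfolding double by simp_all
  have "A (G v w) = (P * m - Q * n) *\<^sub>R A e - (P * n + Q * m) *\<^sub>R A e'"
    unfolding G m_def n_def linear_diff[OF \<open>linear A\<close>] linear_cmul[OF \<open>linear A\<close>] ..
  also have "\<dots> = G (A v) (A w)"
    unfolding G m' n' A by (simp add: algebra_simps)
  finally show ?thesis ..
qed

text \<open>A derivative in direction v sees only the line through the base point. Two base points
  are allowed so that t-derivatives at different points with the same t can be compared.\<close>

lemma directional_derivative_cong:
  fixes g1 g2 :: "'a::real_normed_vector \<Rightarrow> real"
  assumes "(g1 has_derivative g1') (at x)" "(g2 has_derivative g2') (at y)"
    and "open M" "x \<in> M" "y \<in> M"
    and eq: "\<And>r. x + r *\<^sub>R v \<in> M \<Longrightarrow> y + r *\<^sub>R v \<in> M \<Longrightarrow> g1 (x + r *\<^sub>R v) = g2 (y + r *\<^sub>R v)"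
  shows "g1' v = g2' v"
proof -
  define R where "R = (\<lambda>r. x + r *\<^sub>R v) -` M \<inter> (\<lambda>r. y + r *\<^sub>R v) -` M"
  have "open R"
    unfolding R_def using \<open>open M\<close>
    by (intro open_Int open_vimage continuous_intros)
  moreover have "0 \<in> R"
    using assms by (simp add: R_def)
  moreover have g1: "((\<lambda>r. g1 (x + r *\<^sub>R v)) has_real_derivative g1' v) (at 0)"
    and g2: "((\<lambda>r. g2 (y + r *\<^sub>R v)) has_real_derivative g2' v) (at 0)"
    using assms by (auto intro!: has_derivative_along_line)
  ultimately have "((\<lambda>r. g2 (y + r *\<^sub>R v)) has_real_derivative g1' v) (at 0)"
    using eq has_field_derivative_transform_within_open[OF g1, of R "\<lambda>r. g2 (y + r *\<^sub>R v)"]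
    by (auto simp: R_def)
  then show ?thesis
    using g2 by (rule DERIV_unique)
qed

lemma bilinear_real2:
  fixes b :: "real^2 \<Rightarrow> real^2 \<Rightarrow> real"
  assumes "bilinear b" "\<And>v w. b v w = b w v"
  shows "b v w = v$1 * w$1 * b (axis 1 1) (axis 1 1)
    + (v$1 * w$2 + v$2 * w$1) * b (axis 1 1) (axis 2 1) + v$2 * w$2 * b (axis 2 1) (axis 2 1)"
proof -
  have expand: "u = (u$1) *\<^sub>R axis 1 1 + (u$2) *\<^sub>R axis 2 1" for u :: "real^2"
    by (simp add: vec_eq_iff forall_2 axis_def)
  have "b v w = b ((v$1) *\<^sub>R axis 1 1 + (v$2) *\<^sub>R axis 2 1) ((w$1) *\<^sub>R axis 1 1 + (w$2) *\<^sub>R axis 2 1)"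
    using expand[of v] expand[of w] by simp
  also have "\<dots> = v$1 * w$1 * b (axis 1 1) (axis 1 1)
    + (v$1 * w$2 + v$2 * w$1) * b (axis 1 1) (axis 2 1) + v$2 * w$2 * b (axis 2 1) (axis 2 1)"
    using assms(2)[of "axis 2 1" "axis 1 1"]
    by (simp add: bilinear_ladd[OF assms(1)] bilinear_radd[OF assms(1)] bilinear_lmul[OF assms(1)]
        bilinear_rmul[OF assms(1)] algebra_simps)
  finally show ?thesis .
qed

text \<open>Gram-Schmidt on the standard basis gives the frame (x, 0), (y, z), where y cancels the
  mixed term and z normalizes the second vector. Its determinant is simply x z.\<close>

lemma binary_form_orthonormalization:
  fixes a b c :: real
  assumes "a > 0" "a * c - b\<^sup>2 > 0"
  obtains x y z where "x \<noteq> 0" "z \<noteq> 0" "a * x\<^sup>2 = 1" "a * x * y + b * x * z = 0"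
    "a * y\<^sup>2 + 2 * b * y * z + c * z\<^sup>2 = 1"
proof
  define z where "z = sqrt (a / (a * c - b\<^sup>2))"
  have z2: "z\<^sup>2 = a / (a * c - b\<^sup>2)"
    using assms by (simp add: z_def)
  show "1 / sqrt a \<noteq> 0" "z \<noteq> 0" "a * (1 / sqrt a)\<^sup>2 = 1"
    using assms by (auto simp: z_def power_divide)
  show "a * (1 / sqrt a) * (- b * z / a) + b * (1 / sqrt a) * z = 0"
    using assms by (simp add: field_simps)
  have "a * (- b * z / a)\<^sup>2 + 2 * b * (- b * z / a) * z + c * z\<^sup>2 = (a * c - b\<^sup>2) / a * z\<^sup>2"
    using assms by (simp add: field_simps power2_eq_square)
  then show "a * (- b * z / a)\<^sup>2 + 2 * b * (- b * z / a) * z + c * z\<^sup>2 = 1"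
    using assms by (simp add: z2)
qed

lemma orthonormal_frame_2:
  "orthonormal_frame g [a, b :: real^2] \<longleftrightarrow> \<bar>g a a\<bar> = 1 \<and> \<bar>g b b\<bar> = 1 \<and> g a b = 0 \<and> g b a = 0"
  by (auto simp: orthonormal_frame_def All_less_Suc)

lemma orthonormal_frame_3:
  "orthonormal_frame g [a, b, c :: real^3] \<longleftrightarrow>
    \<bar>g a a\<bar> = 1 \<and> \<bar>g b b\<bar> = 1 \<and> \<bar>g c c\<bar> = 1 \<and>
    g a b = 0 \<and> g b a = 0 \<and> g a c = 0 \<and> g c a = 0 \<and> g b c = 0 \<and> g c b = 0"
  by (auto simp: orthonormal_frame_def All_less_Suc)

subsection \<open>The affine metric\<close>

text \<open>Points of the hypersurface domain are (t, u, v); this projects to the domain of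
  f.\<close>

definition base :: "real^3 \<Rightarrow> real^2" where
  "base x = vector [x$2, x$3]"

lemma base_nth [simp]: "base x $ 1 = x$2" "base x $ 2 = x$3"
  by (simp_all add: base_def)

lemma linear_base: "linear base"
  by (rule linearI) (simp_all add: vec_eq_iff forall_2)

lemma bounded_linear_base: "bounded_linear base"
  by (rule linear_base[unfolded linear_conv_bounded_linear])

section \<open>The hypersurface, its conormal and the shape of its metric\<close>

locale translation_hypersurface =
  fixes N :: "(real^2) set" and f :: "real^2 \<Rightarrow> real" and I :: "real set"
    and \<gamma> :: "real \<Rightarrow> real^2" and \<xi> F :: "real^3 \<Rightarrow> real^4" and M :: "(real^3) set"
  defines "M \<equiv> {x. x$1 \<in> I \<and> base x \<in> N}"
    and "F \<equiv> \<lambda>x. vector [x$2, x$3, f (base x) + \<gamma> (x$1) $ 2, \<gamma> (x$1) $ 1]"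
  assumes sphere: "improper_affine_sphere N (\<lambda>y. vector [y$1, y$2, f y]) (vector [0, 0, 1])"
    and smooth_curve: "smooth_on I \<gamma>"
    and positive: "positive_definite_hypersurface M F \<xi>"
begin

definition d1 :: "real \<Rightarrow> real^2" where "d1 t = deriv_at \<gamma> t 1"
definition d2 :: "real \<Rightarrow> real^2" where "d2 t = deriv_at d1 t 1"
definition \<kappa> :: "real \<Rightarrow> real" where "\<kappa> t = d1 t $ 1 * d2 t $ 2 - d1 t $ 2 * d2 t $ 1"

text \<open>A tangent vector has the form (a, b, df(a,b) + s \<gamma>_2', s \<gamma>_1');
  eliminating s leaves this linear form.\<close>

definition \<nu> :: "real^3 \<Rightarrow> real^4 \<Rightarrow> real" where
  "\<nu> x w = d1 (x$1) $ 1 * (w$3 - deriv_at f (base x) (vector [w$1, w$2])) - d1 (x$1) $ 2 * w$4"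

definition \<rho> :: "real^3 \<Rightarrow> real" where "\<rho> x = \<nu> x (\<xi> x)"

abbreviation B :: "real^3 \<Rightarrow> real^3 \<Rightarrow> real^3 \<Rightarrow> real" where
  "B x v w \<equiv> hessian f (base x) (base v) (base w)"

abbreviation E :: "real^3" where "E \<equiv> axis 1 1"

lemma
  shows open_N: "open N"
    and smooth_f: "smooth_on N f"
    and open_M: "open M"
    and smooth_xi: "smooth_on M \<xi>"
    and inj_F: "x \<in> M \<Longrightarrow> inj (deriv_at F x)"
    and xi_transversal: "x \<in> M \<Longrightarrow> \<xi> x \<notin> range (deriv_at F x)"
    and xi_equiaffine: "x \<in> M \<Longrightarrow> deriv_at \<xi> x v \<in> range (deriv_at F x)"
    and smooth_F: "smooth_on M F"
proof -
  have "smooth_on N (\<lambda>y. vector [y$1, y$2, f y] :: real^3)" and *: "open N"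
    using sphere by (auto simp: improper_affine_sphere_def blaschke_hypersurface_def)
  from smooth_on_bounded_linear[OF *(1) bounded_linear_vec_nth[of 3] this(1)]
  show "smooth_on N f"
    by simp
qed (use sphere positive in \<open>auto simp: improper_affine_sphere_def blaschke_hypersurface_def
    positive_definite_hypersurface_def\<close>)

lemma mem_M: "x \<in> M \<longleftrightarrow> x$1 \<in> I \<and> base x \<in> N"
  by (simp add: M_def)

lemma
  assumes "t \<in> I"
  shows curve_has_derivative: "(\<gamma> has_derivative (\<lambda>s. s *\<^sub>R d1 t)) (at t)"
    and d1_has_derivative: "(d1 has_derivative (\<lambda>s. s *\<^sub>R d2 t)) (at t)"
    and d2_has_derivative: "(d2 has_derivative (\<lambda>s. s *\<^sub>R deriv_at d2 t 1)) (at t)"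
proof -
  have scale: "(g has_derivative (\<lambda>s. s *\<^sub>R deriv_at g t 1)) (at t)" if "smooth_on I g"
    for g :: "real \<Rightarrow> real^2"
  proof -
    have der: "(g has_derivative deriv_at g t) (at t)"
      using that assms by (rule smooth_on_has_derivative)
    have "deriv_at g t s = s *\<^sub>R deriv_at g t 1" for s
      using linear_cmul[OF has_derivative_linear[OF der], of s 1] by simp
    then show ?thesis
      by (rule has_derivative_eq_rhs[OF der ext])
  qed
  have s1: "smooth_on I d1"
    using smooth_on_deriv[OF smooth_curve] by (simp add: d1_def[abs_def])
  then have s2: "smooth_on I d2"
    using smooth_on_deriv[OF s1] by (simp add: d2_def[abs_def])
  show "(\<gamma> has_derivative (\<lambda>s. s *\<^sub>R d1 t)) (at t)"
    "(d1 has_derivative (\<lambda>s. s *\<^sub>R d2 t)) (at t)"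
    "(d2 has_derivative (\<lambda>s. s *\<^sub>R deriv_at d2 t 1)) (at t)"
    using scale[OF smooth_curve] scale[OF s1] scale[OF s2] by (simp_all add: d1_def d2_def)
qed

lemma has_derivative_first:
  assumes "x \<in> M" "(g has_derivative (\<lambda>s. s *\<^sub>R g')) (at (x$1))"
  shows "((\<lambda>x. g (x$1) $ i) has_derivative (\<lambda>v. v$1 * g' $ i)) (at x)"
proof -
  have "((\<lambda>x. g (x$1)) has_derivative (\<lambda>v. v$1 *\<^sub>R g')) (at x)"
    using has_derivative_compose[OF bounded_linear.has_derivative[OF bounded_linear_vec_nth has_derivative_ident] assms(2)] .
  from bounded_linear.has_derivative[OF bounded_linear_vec_nth this] show ?thesis
    by simp
qed

lemma has_derivative_base:
  assumes "(g has_derivative g') (at (base x))"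
  shows "((\<lambda>x. g (base x)) has_derivative (\<lambda>v. g' (base v))) (at x)"
  using has_derivative_compose[OF bounded_linear.has_derivative[OF bounded_linear_base has_derivative_ident] assms] .

lemmas curve_M = has_derivative_first[OF _ curve_has_derivative]
lemmas d1_M = has_derivative_first[OF _ d1_has_derivative]
lemmas d2_M = has_derivative_first[OF _ d2_has_derivative]

lemma F_has_derivative:
  assumes "x \<in> M"
  shows "(F has_derivative (\<lambda>v. vector [v$2, v$3,
    deriv_at f (base x) (base v) + v$1 * d1 (x$1) $ 2, v$1 * d1 (x$1) $ 1])) (at x)"
  unfolding F_def using assms
  by (intro has_derivative_vector_4 derivative_intros curve_M has_derivative_base
      smooth_on_has_derivative[OF smooth_f] bounded_linear.has_derivative[OF bounded_linear_vec_nth])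
    (auto simp: mem_M)

lemma deriv_F: "x \<in> M \<Longrightarrow> deriv_at F x v = vector [v$2, v$3,
    deriv_at f (base x) (base v) + v$1 * d1 (x$1) $ 2, v$1 * d1 (x$1) $ 1]"
  using deriv_at_eq[OF F_has_derivative] by simp

lemma linear_deriv_F: "x \<in> M \<Longrightarrow> linear (deriv_at F x)"
  using has_derivative_linear[OF smooth_on_has_derivative[OF smooth_F]] .

lemma F_second_derivative:
  assumes "x \<in> M"
  shows "deriv_at (\<lambda>q. deriv_at F q w) x v = vector [0, 0,
    B x v w + v$1 * w$1 * d2 (x$1) $ 2, v$1 * w$1 * d2 (x$1) $ 1]"
proof -
  have "((\<lambda>q. vector [w$2, w$3, deriv_at f (base q) (base w) + w$1 * d1 (q$1) $ 2, w$1 * d1 (q$1) $ 1] :: real^4)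
      has_derivative (\<lambda>v. vector [0, 0,
        hessian f (base x) (base v) (base w) + w$1 * (v$1 * d2 (x$1) $ 2), w$1 * (v$1 * d2 (x$1) $ 1)])) (at x)"
    using assms
    by (intro has_derivative_vector_4 derivative_intros has_derivative_mult_right d1_M
        has_derivative_base[OF hessian_has_derivative[OF smooth_f]]) (auto simp: mem_M)
  from has_derivative_transform_within_open[OF this open_M assms, of "\<lambda>q. deriv_at F q w"]
  show ?thesis
    by (simp add: deriv_F deriv_at_eq mult_ac)
qed

lemma linear_deriv_f: "y \<in> N \<Longrightarrow> linear (deriv_at f y)"
  using has_derivative_linear[OF smooth_on_has_derivative[OF smooth_f]] .

lemma conormal_add: "x \<in> M \<Longrightarrow> \<nu> x (v + w) = \<nu> x v + \<nu> x w"
proof -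
  have "vector [(v + w)$1, (v + w)$2] = (vector [v$1, v$2] + vector [w$1, w$2] :: real^2)"
    by (simp add: vec_eq_iff forall_2)
  then show "x \<in> M \<Longrightarrow> ?thesis"
    using linear_add[OF linear_deriv_f, of "base x"] by (simp add: \<nu>_def mem_M algebra_simps)
qed

lemma conormal_scaleR: "x \<in> M \<Longrightarrow> \<nu> x (c *\<^sub>R w) = c * \<nu> x w"
proof -
  have "vector [(c *\<^sub>R w)$1, (c *\<^sub>R w)$2] = c *\<^sub>R (vector [w$1, w$2] :: real^2)"
    by (simp add: vec_eq_iff forall_2)
  then show "x \<in> M \<Longrightarrow> ?thesis"
    using linear_cmul[OF linear_deriv_f, of "base x" c "vector [w$1, w$2]"]
    by (simp add: \<nu>_def mem_M algebra_simps)
qed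

lemma conormal_tangent: "x \<in> M \<Longrightarrow> \<nu> x (deriv_at F x v) = 0"
  by (simp add: \<nu>_def deriv_F base_def)

text \<open>Together with \<open>conormal_tangent\<close> this identifies the tangent space with the
  kernel of \<open>\<nu>\<close>, so that \<open>\<nu>\<close> detects transversal parts.
  Injectivity of dF enters through \<gamma>' \<noteq> 0.\<close>

lemma conormal_kernel:
  assumes "x \<in> M" "\<nu> x z = 0"
  shows "z \<in> range (deriv_at F x)"
proof -
  define p q r where "p = d1 (x$1) $ 1" and "q = d1 (x$1) $ 2"
    and "r = z$3 - deriv_at f (base x) (vector [z$1, z$2])"
  have "p\<^sup>2 + q\<^sup>2 \<noteq> 0"
  proof
    assume "p\<^sup>2 + q\<^sup>2 = 0"
    then have "deriv_at F x E = deriv_at F x 0"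
      using assms by (simp add: deriv_F p_def q_def base_def axis_def)
    then show False
      using inj_F[OF assms(1)] by (simp add: inj_eq)
  qed
  \<comment> \<open>By the tangency equation (z$4, r) is a multiple of (p, q). The first entry is
    that factor, written so that it does not matter which of p and q is nonzero.\<close>
  define X where "X = (vector [(p * z$4 + q * r) / (p\<^sup>2 + q\<^sup>2), z$1, z$2] :: real^3)"
  have "p * r = q * z$4"
    using assms(2) by (simp add: \<nu>_def p_def q_def r_def)
  have "p * (p * z$4 + q * r) = (p\<^sup>2 + q\<^sup>2) * z$4" "q * (p * z$4 + q * r) = (p\<^sup>2 + q\<^sup>2) * r"
    using \<open>p * r = q * z$4\<close> by algebra+
  then have "X$1 * p = z$4" "X$1 * q = r"
    using \<open>p\<^sup>2 + q\<^sup>2 \<noteq> 0\<close> by (simp_all add: X_def divide_simps mult.commute)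
  moreover have "base X = vector [z$1, z$2]" "X$2 = z$1" "X$3 = z$2"
    by (simp_all add: X_def base_def)
  ultimately have "deriv_at F x X = vector [z$1, z$2, z$3, z$4]"
    by (simp add: deriv_F[OF assms(1)] p_def q_def r_def)
  also have "\<dots> = z"
    by (simp add: vec_eq_iff forall_4)
  finally show ?thesis
    by blast
qed

lemma rho_nonzero: "x \<in> M \<Longrightarrow> \<rho> x \<noteq> 0"
  using conormal_kernel xi_transversal by (auto simp: \<rho>_def)

text \<open>Applying \<open>\<nu>\<close> to the Gauss formula kills the tangential part, so the
  metric is \<open>\<nu>\<close> of the second derivative divided by \<open>\<nu>\<close> of the
  normal.\<close>

lemma metric_eq:
  assumes "x \<in> M"
  shows "affine_metric F \<xi> x v w = (d1 (x$1) $ 1 * B x v w + \<kappa> (x$1) * v$1 * w$1) / \<rho> x"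
proof -
  define z where "z = deriv_at (\<lambda>q. deriv_at F q w) x v"
  have "\<nu> x (z - (\<nu> x z / \<rho> x) *\<^sub>R \<xi> x) = 0"
    using conormal_add[OF assms, of z "- (\<nu> x z / \<rho> x) *\<^sub>R \<xi> x"] conormal_scaleR[OF assms, of "- (\<nu> x z / \<rho> x)" "\<xi> x"]
      rho_nonzero[OF assms] by (simp add: \<rho>_def)
  then obtain X where "z - (\<nu> x z / \<rho> x) *\<^sub>R \<xi> x = deriv_at F x X"
    using conormal_kernel[OF assms] by blast
  then have "transversal_part F \<xi> x z = \<nu> x z / \<rho> x"
    using assms by (intro transversal_tangential_eqI linear_deriv_F inj_F xi_transversal)
      (auto simp: algebra_simps)
  moreover have zero2: "vector [0, 0] = (0 :: real^2)"
    by (simp add: vec_eq_iff forall_2)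
  have "\<nu> x z = d1 (x$1) $ 1 * B x v w + \<kappa> (x$1) * v$1 * w$1"
    using linear_0[OF linear_deriv_f, of "base x"] assms zero2
    by (simp add: z_def \<nu>_def F_second_derivative mem_M \<kappa>_def algebra_simps)
  ultimately show ?thesis
    by (simp add: affine_metric_def z_def)
qed

text \<open>Coefficients of Hess f and of dt^2 in the metric. \<open>\<alpha>\<close> can be
  negative, namely when Hess f is negative definite.\<close>

definition \<alpha> :: "real^3 \<Rightarrow> real" where "\<alpha> x = d1 (x$1) $ 1 / \<rho> x"
definition \<beta> :: "real^3 \<Rightarrow> real" where "\<beta> x = \<kappa> (x$1) / \<rho> x"

lemma metric: "x \<in> M \<Longrightarrow> affine_metric F \<xi> x v w = \<alpha> x * B x v w + \<beta> x * v$1 * w$1"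
  by (simp add: metric_eq \<alpha>_def \<beta>_def add_divide_distrib)

lemma metric_positive: "x \<in> M \<Longrightarrow> v \<noteq> 0 \<Longrightarrow> \<alpha> x * B x v v + \<beta> x * v$1 * v$1 > 0"
  using positive unfolding positive_definite_hypersurface_def by (simp flip: metric)

lemma hess_commute: "y \<in> N \<Longrightarrow> hessian f y v w = hessian f y w v"
  by (rule hessian_commute[OF open_N smooth_f])

lemma hess_bilinear: "y \<in> N \<Longrightarrow> bilinear (hessian f y)"
  by (rule hessian_bilinear[OF open_N smooth_f])

lemma base_E [simp]: "base E = 0"
  by (simp add: vec_eq_iff forall_2 axis_def)

lemma E_nth [simp]: "E $ 1 = 1" "E $ 2 = 0" "E $ 3 = 0"
  by (simp_all add: axis_def)

lemma base_vector [simp]: "base (vector [a, b, c]) = vector [b, c]"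
  by (simp add: base_def)

lemma fibre_positive:
  assumes "x \<in> M" "y \<noteq> 0"
  shows "\<alpha> x * hessian f (base x) y y > 0"
proof -
  have y: "base (vector [0, y$1, y$2]) = y"
    by (simp add: vec_eq_iff forall_2)
  then have "vector [0, y$1, y$2] \<noteq> (0 :: real^3)"
    using assms(2) linear_0[OF linear_base] by metis
  from metric_positive[OF assms(1) this] show ?thesis
    unfolding y by simp
qed

lemma beta_positive: "x \<in> M \<Longrightarrow> \<beta> x > 0"
  using metric_positive[of x E] bilinear_lzero[OF hess_bilinear, of "base x" 0]
  by (simp add: mem_M axis_eq_0_iff)

lemma alpha_nonzero: "x \<in> M \<Longrightarrow> \<alpha> x \<noteq> 0"
  using fibre_positive[of x "axis 1 1"] by (auto simp: axis_eq_0_iff)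

section \<open>Volume normalization in adapted frames\<close>

abbreviation f11 :: "real^2 \<Rightarrow> real" where "f11 y \<equiv> hessian f y (axis 1 1) (axis 1 1)"
abbreviation f12 :: "real^2 \<Rightarrow> real" where "f12 y \<equiv> hessian f y (axis 1 1) (axis 2 1)"
abbreviation f22 :: "real^2 \<Rightarrow> real" where "f22 y \<equiv> hessian f y (axis 2 1) (axis 2 1)"

lemma hess_coords: "y \<in> N \<Longrightarrow> hessian f y v w
    = v$1 * w$1 * f11 y + (v$1 * w$2 + v$2 * w$1) * f12 y + v$2 * w$2 * f22 y"
  using hess_bilinear hess_commute by (rule bilinear_real2)

lemma deriv_coords:
  assumes "y \<in> N"
  shows "deriv_at f y v = v$1 * deriv_at f y (axis 1 1) + v$2 * deriv_at f y (axis 2 1)"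
proof -
  have "deriv_at f y v = deriv_at f y ((v$1) *\<^sub>R axis 1 1 + (v$2) *\<^sub>R axis 2 1)"
    by (rule arg_cong[where f = "deriv_at f y"]) (simp add: vec_eq_iff forall_2 axis_def)
  then show ?thesis
    by (simp add: linear_add[OF linear_deriv_f[OF assms]] linear_cmul[OF linear_deriv_f[OF assms]])
qed

lemma hess_vector: "y \<in> N \<Longrightarrow> hessian f y (vector [p, q]) (vector [r, s])
    = p * r * f11 y + (p * s + q * r) * f12 y + q * s * f22 y"
  by (subst hess_coords) simp_all

lemma deriv_vector: "y \<in> N \<Longrightarrow> deriv_at f y (vector [p, q])
    = p * deriv_at f y (axis 1 1) + q * deriv_at f y (axis 2 1)"
  by (subst deriv_coords) simp_all

text \<open>The vectors (X, 0) and (Y, Z) form an orthonormal frame of the (u,v)-plane for the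
  metric restricted to the fibre. The triangular shape makes its determinant X Z.\<close>

definition adapted :: "real^3 \<Rightarrow> real \<Rightarrow> real \<Rightarrow> real \<Rightarrow> bool" where
  "adapted x X Y Z \<longleftrightarrow> X \<noteq> 0 \<and> Z \<noteq> 0 \<and>
    \<alpha> x * hessian f (base x) (vector [X, 0]) (vector [X, 0]) = 1 \<and>
    \<alpha> x * hessian f (base x) (vector [X, 0]) (vector [Y, Z]) = 0 \<and>
    \<alpha> x * hessian f (base x) (vector [Y, Z]) (vector [Y, Z]) = 1"

lemma adapted_exists:
  assumes "x \<in> M"
  obtains X Y Z where "adapted x X Y Z"
proof -
  define a b c where "a = \<alpha> x * f11 (base x)" and "b = \<alpha> x * f12 (base x)" and "c = \<alpha> x * f22 (base x)"
  have y: "base x \<in> N"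
    using assms by (simp add: mem_M)
  have "a > 0"
    unfolding a_def by (rule fibre_positive[OF assms]) (simp add: axis_eq_0_iff)
  \<comment> \<open>On this vector the form with coefficients a, b, c takes the value a (a c -
    b^2).\<close>
  have "vector [- b, a] \<noteq> (0 :: real^2)"
    using \<open>a > 0\<close> by (auto simp: vec_eq_iff forall_2)
  from fibre_positive[OF assms this] have "a * (a * c - b\<^sup>2) > 0"
    unfolding hess_vector[OF y] by (simp add: a_def b_def c_def algebra_simps power2_eq_square)
  then have "a * c - b\<^sup>2 > 0"
    using \<open>a > 0\<close> by (simp add: zero_less_mult_iff)
  with \<open>a > 0\<close> obtain X Y Z where "X \<noteq> 0" "Z \<noteq> 0" "a * X\<^sup>2 = 1" "a * X * Y + b * X * Z = 0"
    "a * Y\<^sup>2 + 2 * b * Y * Z + c * Z\<^sup>2 = 1"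
    by (rule binary_form_orthonormalization)
  then have "adapted x X Y Z"
    unfolding adapted_def hess_vector[OF y]
    by (simp add: a_def b_def c_def algebra_simps power2_eq_square)
  then show thesis
    by (rule that)
qed

text \<open>For the graph of f with normal (0,0,1) the affine metric is Hess f itself, so this is
  the Blaschke volume condition of the improper affine sphere. The absolute values admit a negative
  definite Hessian.\<close>

lemma hessian_frame_volume:
  assumes "y \<in> N" "\<bar>hessian f y u u\<bar> = 1" "\<bar>hessian f y v v\<bar> = 1" "hessian f y u v = 0"
  shows "\<bar>u$1 * v$2 - u$2 * v$1\<bar> = 1"
proof -
  let ?\<psi> = "\<lambda>y. vector [y$1, y$2, f y] :: real^3" and ?c = "vector [0, 0, 1] :: real^3"
  have bl: "blaschke_hypersurface N ?\<psi> (\<lambda>_. ?c)"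
    using sphere by (simp add: improper_affine_sphere_def)
  have der: "(?\<psi> has_derivative (\<lambda>v. vector [v$1, v$2, deriv_at f y v])) (at y)" if "y \<in> N" for y
    using that by (intro has_derivative_vector_3 derivative_intros smooth_on_has_derivative[OF smooth_f]
        bounded_linear.has_derivative[OF bounded_linear_vec_nth])
  have d\<psi>: "deriv_at ?\<psi> y v = vector [v$1, v$2, deriv_at f y v]" if "y \<in> N" for y v
    using deriv_at_eq[OF der[OF that]] by simp
  have second: "deriv_at (\<lambda>q. deriv_at ?\<psi> q w) y v = vector [0, 0, hessian f y v w]" for v w
  proof -
    have "((\<lambda>q. vector [w$1, w$2, deriv_at f q w] :: real^3)
        has_derivative (\<lambda>v. vector [0, 0, hessian f y v w])) (at y)"
      using assms by (intro has_derivative_vector_3 derivative_intros hessian_has_derivative[OF smooth_f])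
    from has_derivative_transform_within_open[OF this open_N assms(1), of "\<lambda>q. deriv_at ?\<psi> q w"]
    show ?thesis
      by (simp add: d\<psi> deriv_at_eq)
  qed
  have metric: "affine_metric ?\<psi> (\<lambda>_. ?c) y v w = hessian f y v w" for v w
    unfolding affine_metric_def second
  proof (rule transversal_tangential_eqI(1))
    show "linear (deriv_at ?\<psi> y)"
      using has_derivative_linear[OF has_derivative_deriv_at] der[OF assms(1)] differentiable_def by blast
    show "inj (deriv_at ?\<psi> y)" "?c \<notin> range (deriv_at ?\<psi> y)"
      using bl assms(1) by (auto simp: blaschke_hypersurface_def)
    show "vector [0, 0, hessian f y v w] = deriv_at ?\<psi> y 0 + hessian f y v w *\<^sub>R ?c"
      using linear_0[OF linear_deriv_f[OF assms(1)]]
      by (simp add: d\<psi>[OF assms(1)] vec_eq_iff forall_3)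
  qed
  have "orthonormal_frame (affine_metric ?\<psi> (\<lambda>_. ?c) y) [u, v]"
    using assms hess_commute[of y v u] by (simp add: orthonormal_frame_2 metric)
  then have "\<bar>det (vector (map (deriv_at ?\<psi> y) [u, v] @ [?c]))\<bar> = 1"
    using bl assms(1) unfolding blaschke_hypersurface_def by blast
  then show ?thesis
    by (simp add: d\<psi>[OF assms(1)] det_3)
qed

text \<open>Scaled by the square root of \<bar>\<alpha>\<bar>, an adapted frame is orthonormal for
  Hess f up to sign, so it has determinant of modulus one.\<close>

lemma adapted_alpha:
  assumes "x \<in> M" "adapted x X Y Z"
  shows "(\<alpha> x)\<^sup>2 * X\<^sup>2 * Z\<^sup>2 = 1"
proof -
  have y: "base x \<in> N"
    using assms by (simp add: mem_M)
  define s where "s = sqrt \<bar>\<alpha> x\<bar>"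
  have s: "s * s = \<bar>\<alpha> x\<bar>"
    by (simp add: s_def)
  have scale: "hessian f (base x) (s *\<^sub>R u) (s *\<^sub>R v) = \<bar>\<alpha> x\<bar> * hessian f (base x) u v" for u v
    by (simp add: bilinear_lmul[OF hess_bilinear[OF y]] bilinear_rmul[OF hess_bilinear[OF y]] s
        flip: mult.assoc)
  have "\<bar>(s *\<^sub>R vector [X, 0] :: real^2) $ 1 * (s *\<^sub>R vector [Y, Z] :: real^2) $ 2
      - (s *\<^sub>R vector [X, 0] :: real^2) $ 2 * (s *\<^sub>R vector [Y, Z] :: real^2) $ 1\<bar> = 1"
    using assms(2) alpha_nonzero[OF assms(1)] unfolding adapted_def
    by (intro hessian_frame_volume[OF y]) (auto simp: scale simp flip: abs_mult)
  then have "\<bar>\<alpha> x * X * Z\<bar> = 1"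
    using s by (simp add: abs_mult algebra_simps flip: mult.assoc)
  then have "(\<alpha> x * X * Z)\<^sup>2 = 1"
    by (metis power2_abs one_power2)
  then show ?thesis
    by (simp add: power_mult_distrib)
qed

lemma adapted_metric:
  assumes "x \<in> M" "adapted x X Y Z"
  shows "orthonormal_frame (affine_metric F \<xi> x)
    [(1 / sqrt (\<beta> x)) *\<^sub>R E, vector [0, X, 0], vector [0, Y, Z]]"
proof -
  have y: "base x \<in> N"
    using assms by (simp add: mem_M)
  have "base ((1 / sqrt (\<beta> x)) *\<^sub>R E) = 0"
    by (simp add: linear_cmul[OF linear_base])
  then show ?thesis
    using assms beta_positive[OF assms(1)] hess_commute[OF y, of "vector [Y, Z]" "vector [X, 0]"]
    by (simp add: orthonormal_frame_3 metric adapted_def bilinear_lzero[OF hess_bilinear[OF y]]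
        bilinear_rzero[OF hess_bilinear[OF y]])
qed

text \<open>The Blaschke volume condition of the hypersurface: the determinant of the orthonormal
  frame and the normal has modulus \<bar>X Z \<rho>\<bar> / sqrt \<beta>.\<close>

lemma adapted_rho:
  assumes "x \<in> M" "adapted x X Y Z"
  shows "(\<rho> x)\<^sup>2 * X\<^sup>2 * Z\<^sup>2 = \<beta> x"
proof -
  have y: "base x \<in> N"
    using assms by (simp add: mem_M)
  have "\<bar>det (vector (map (deriv_at F x)
      [(1 / sqrt (\<beta> x)) *\<^sub>R E, vector [0, X, 0], vector [0, Y, Z]] @ [\<xi> x]))\<bar> = 1"
    using positive adapted_metric[OF assms] assms(1)
    unfolding positive_definite_hypersurface_def blaschke_hypersurface_def by blast
  moreover have "det (vector (map (deriv_at F x)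
      [(1 / sqrt (\<beta> x)) *\<^sub>R E, vector [0, X, 0], vector [0, Y, Z]] @ [\<xi> x])) = - (X * Z * \<rho> x / sqrt (\<beta> x))"
    by (simp add: det_4 deriv_F[OF assms(1)] \<rho>_def \<nu>_def deriv_vector[OF y] linear_0[OF linear_deriv_f[OF y]] linear_cmul[OF linear_base] field_simps)
      (simp add: add_divide_distrib diff_divide_distrib)
  ultimately have "\<bar>X * Z * \<rho> x / sqrt (\<beta> x)\<bar> = 1"
    by (simp only: abs_minus_cancel)
  then have "(X * Z * \<rho> x / sqrt (\<beta> x))\<^sup>2 = 1"
    by (metis power2_abs one_power2)
  then show ?thesis
    using beta_positive[OF assms(1)] by (simp add: power_divide power_mult_distrib algebra_simps)
qed

text \<open>Eliminating X^2 Z^2 from the two volume conditions gives \<rho>^2 = \<beta> \<alpha>^2,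
  and \<open>\<alpha>\<close> and \<open>\<beta>\<close> together contribute three factors
  1/\<rho>.\<close>

lemma rho_power5:
  assumes "x \<in> M"
  shows "(\<rho> x)^5 = \<kappa> (x$1) * (d1 (x$1) $ 1)\<^sup>2"
proof -
  obtain X Y Z where ad: "adapted x X Y Z"
    using adapted_exists[OF assms] .
  have "(\<rho> x)\<^sup>2 = \<beta> x * (\<alpha> x)\<^sup>2"
    using adapted_alpha[OF assms ad] adapted_rho[OF assms ad] by algebra
  also have "\<dots> * (\<rho> x)^3 = \<kappa> (x$1) * (d1 (x$1) $ 1)\<^sup>2"
    using rho_nonzero[OF assms] by (simp add: \<alpha>_def \<beta>_def power_divide field_simps power2_eq_square power3_eq_cube)
  finally show ?thesis
    by (simp flip: power_add)
qed

text \<open>The Gram determinant of an adapted frame is 1 and also equals \<alpha>^2 X^2 Z^2 times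
  the Hessian determinant.\<close>

lemma hessian_det:
  assumes "x \<in> M"
  shows "f11 (base x) * f22 (base x) - (f12 (base x))\<^sup>2 = 1"
proof -
  obtain X Y Z where ad: "adapted x X Y Z"
    using adapted_exists[OF assms] .
  have y: "base x \<in> N"
    using assms by (simp add: mem_M)
  have "(\<alpha> x)\<^sup>2 * X\<^sup>2 * Z\<^sup>2 * (f11 (base x) * f22 (base x) - (f12 (base x))\<^sup>2) = 1"
    using ad unfolding adapted_def hess_vector[OF y] by simp algebra
  then show ?thesis
    using adapted_alpha[OF assms ad] by simp
qed

subsection \<open>The affine normal and the shape operator\<close>

lemma hess_lincomb:
  assumes "y \<in> N"
  shows "hessian f y v (vector [p, q])
    = p * hessian f y v (axis 1 1) + q * hessian f y v (axis 2 1)"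
proof -
  have "vector [p, q] = p *\<^sub>R axis 1 1 + q *\<^sub>R (axis 2 1 :: real^2)"
    by (simp add: vec_eq_iff forall_2 axis_def)
  then show ?thesis
    by (simp add: bilinear_radd[OF hess_bilinear[OF assms]] bilinear_rmul[OF hess_bilinear[OF assms]])
qed

lemma xi_has_derivative:
  "x \<in> M \<Longrightarrow> ((\<lambda>q. \<xi> q $ i) has_derivative (\<lambda>v. deriv_at \<xi> x v $ i)) (at x)"
  by (rule bounded_linear.has_derivative[OF bounded_linear_vec_nth smooth_on_has_derivative[OF smooth_xi]])

text \<open>In the derivative of \<nu>(\<xi>) the terms containing D\<xi> add up to \<nu>(D\<xi>),
  which vanishes because D\<xi> is tangent. What remains is the derivative of \<open>\<nu>\<close>
  evaluated on \<xi>.\<close>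

lemma rho_has_derivative_raw:
  assumes "x \<in> M"
  shows "(\<rho> has_derivative (\<lambda>v.
    v$1 * (d2 (x$1) $ 1 * (\<xi> x $ 3 - deriv_at f (base x) (vector [\<xi> x $ 1, \<xi> x $ 2])) - d2 (x$1) $ 2 * \<xi> x $ 4)
    - d1 (x$1) $ 1 * hessian f (base x) (base v) (vector [\<xi> x $ 1, \<xi> x $ 2]))) (at x)"
proof -
  have y: "base x \<in> N" and t: "x$1 \<in> I"
    using assms by (simp_all add: mem_M)
  have conormal_zero: "\<nu> x (deriv_at \<xi> x v) = 0" for v
    using xi_equiaffine[OF assms, of v] conormal_tangent[OF assms] by auto
  \<comment> \<open>The direction in which f is differentiated varies with q, so it is expanded in
    the standard basis before the product rule is used.\<close>
  have "((\<lambda>q. d1 (q$1) $ 1 * (\<xi> q $ 3 - (\<xi> q $ 1 * deriv_at f (base q) (axis 1 1)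
        + \<xi> q $ 2 * deriv_at f (base q) (axis 2 1))) - d1 (q$1) $ 2 * \<xi> q $ 4)
      has_derivative (\<lambda>v. (d1 (x$1) $ 1 * (deriv_at \<xi> x v $ 3
          - ((\<xi> x $ 1 * hessian f (base x) (base v) (axis 1 1) + deriv_at \<xi> x v $ 1 * deriv_at f (base x) (axis 1 1))
          + (\<xi> x $ 2 * hessian f (base x) (base v) (axis 2 1) + deriv_at \<xi> x v $ 2 * deriv_at f (base x) (axis 2 1))))
        + (v$1 * d2 (x$1) $ 1) * (\<xi> x $ 3 - (\<xi> x $ 1 * deriv_at f (base x) (axis 1 1)
        + \<xi> x $ 2 * deriv_at f (base x) (axis 2 1))))
        - (d1 (x$1) $ 2 * deriv_at \<xi> x v $ 4 + (v$1 * d2 (x$1) $ 2) * \<xi> x $ 4))) (at x)"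
    by (intro has_derivative_diff has_derivative_add has_derivative_mult d1_M[OF assms t]
        xi_has_derivative[OF assms] has_derivative_base[OF hessian_has_derivative[OF smooth_f y]])
  from has_derivative_transform_within_open[OF this open_M assms, of \<rho>]
  show ?thesis
  proof (rule has_derivative_eq_rhs)
    fix q assume "q \<in> M"
    then show "d1 (q$1) $ 1 * (\<xi> q $ 3 - (\<xi> q $ 1 * deriv_at f (base q) (axis 1 1)
        + \<xi> q $ 2 * deriv_at f (base q) (axis 2 1))) - d1 (q$1) $ 2 * \<xi> q $ 4 = \<rho> q"
      by (simp add: \<rho>_def \<nu>_def deriv_vector mem_M)
  qed (rule ext, use conormal_zero in \<open>simp add: \<nu>_def deriv_vector[OF y] hess_lincomb[OF y] algebra_simps\<close>)
qed

text \<open>By \<open>rho_power5\<close> the fifth power of \<open>\<rho>\<close> is constant along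
  lines with fixed t, and \<open>\<rho>\<close> does not vanish.\<close>

lemma rho_vertical:
  assumes "x \<in> M" "v$1 = 0" and der: "(\<rho> has_derivative \<rho>') (at x)"
  shows "\<rho>' v = 0"
proof -
  have "((\<lambda>q. \<rho> q ^ 5) has_derivative (\<lambda>v. of_nat 5 * \<rho>' v * \<rho> x ^ (5 - 1))) (at x)"
    by (rule has_derivative_power[OF der])
  from directional_derivative_cong[OF this has_derivative_const[of "\<rho> x ^ 5"] open_M assms(1) assms(1), of v]
  have "of_nat 5 * \<rho>' v * \<rho> x ^ (5 - 1) = 0"
    using assms by (simp add: rho_power5)
  then show ?thesis
    using rho_nonzero[OF assms(1)] by simp
qed

text \<open>Let w be the (u,v)-part of \<xi>. Differentiating \<open>\<rho>\<close> along w gives -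
  \<gamma>_1' Hess f(w,w), which must vanish; definiteness of the fibre metric forces w = 0.\<close>

lemma xi_vertical:
  assumes "x \<in> M"
  shows "\<xi> x $ 1 = 0" "\<xi> x $ 2 = 0"
proof -
  define w where "w = (vector [\<xi> x $ 1, \<xi> x $ 2] :: real^2)"
  have "w = 0"
  proof (rule ccontr)
    assume "w \<noteq> 0"
    then have "\<alpha> x * hessian f (base x) w w > 0"
      by (rule fibre_positive[OF assms])
    moreover have "d1 (x$1) $ 1 * hessian f (base x) w w = 0"
      using rho_vertical[OF assms _ rho_has_derivative_raw[OF assms], of "vector [0, \<xi> x $ 1, \<xi> x $ 2]"]
      by (simp add: w_def)
    ultimately show False
      by (auto simp: \<alpha>_def)
  qed
  then show "\<xi> x $ 1 = 0" "\<xi> x $ 2 = 0"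
    by (simp_all add: w_def vec_eq_iff forall_2)
qed

section \<open>Dependence of the affine normal on t alone, and its consequences\<close>

lemma vector_0_0 [simp]: "vector [0, 0] = (0 :: real^2)"
  by (simp add: vec_eq_iff forall_2)

text \<open>The t-derivative of \<open>\<rho>\<close>: D\<xi> drops out, so only \<gamma>' is
  replaced by \<gamma>''.\<close>

definition \<eta> :: "real^3 \<Rightarrow> real" where
  "\<eta> x = d2 (x$1) $ 1 * \<xi> x $ 3 - d2 (x$1) $ 2 * \<xi> x $ 4"

lemma rho_eq: "x \<in> M \<Longrightarrow> \<rho> x = d1 (x$1) $ 1 * \<xi> x $ 3 - d1 (x$1) $ 2 * \<xi> x $ 4"
  using linear_0[OF linear_deriv_f, of "base x"] by (simp add: \<rho>_def \<nu>_def xi_vertical mem_M)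

lemma rho_has_derivative:
  assumes "x \<in> M"
  shows "(\<rho> has_derivative (\<lambda>v. v$1 * \<eta> x)) (at x)"
  using rho_has_derivative_raw[OF assms] linear_0[OF linear_deriv_f, of "base x"]
    bilinear_rzero[OF hess_bilinear, of "base x"] assms
  by (simp add: xi_vertical \<eta>_def mem_M)

lemma xi_deriv_vertical:
  assumes "x \<in> M"
  shows "deriv_at \<xi> x v $ 1 = 0" "deriv_at \<xi> x v $ 2 = 0"
proof -
  have "((\<lambda>q. \<xi> q $ i) has_derivative (\<lambda>_. 0)) (at x)" if "i = 1 \<or> i = 2" for i
    using that by (intro has_derivative_transform_within_open[OF has_derivative_const[of 0] open_M assms])
      (auto simp: xi_vertical)
  then show "deriv_at \<xi> x v $ 1 = 0" "deriv_at \<xi> x v $ 2 = 0"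
    using has_derivative_unique[OF xi_has_derivative[OF assms]] by metis+
qed

text \<open>
  \<open>\<rho>\<^sup>5\<close> is a function of \<open>t\<close> alone, hence so is its \<open>t\<close>-derivative \<open>5 \<rho>\<^sup>4 \<eta>\<close>. Differentiating both along the
  fibre gives two independent linear equations for the derivatives of \<open>\<xi>\<^sub>3, \<xi>\<^sub>4\<close>.
\<close>

lemma xi_deriv_fibre:
  assumes "x \<in> M" "v$1 = 0"
  shows "deriv_at \<xi> x v = 0"
proof -
  have t: "x$1 \<in> I"
    using assms by (simp add: mem_M)
  \<comment> \<open>One fifth of the t-derivative of \<open>\<rho> ^ 5\<close>.\<close>
  define \<Phi> where "\<Phi> q = \<rho> q ^ 4 * \<eta> q" for q
  have Phi_eq: "\<Phi> p = \<Phi> q" if "p \<in> M" "q \<in> M" "p$1 = q$1" for p q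
  proof -
    have der: "((\<lambda>q. \<rho> q ^ 5) has_derivative (\<lambda>v. of_nat 5 * (v$1 * \<eta> q) * \<rho> q ^ (5 - 1))) (at q)"
      if "q \<in> M" for q
      by (rule has_derivative_power[OF rho_has_derivative[OF that]])
    from directional_derivative_cong[OF der der open_M, of p q E] that
    show ?thesis
      by (simp add: \<Phi>_def rho_power5 mult_ac)
  qed
  have "(\<Phi> has_derivative (\<lambda>v. \<rho> x ^ 4 * ((d2 (x$1) $ 1 * deriv_at \<xi> x v $ 3 + (v$1 * deriv_at d2 (x$1) 1 $ 1) * \<xi> x $ 3)
      - (d2 (x$1) $ 2 * deriv_at \<xi> x v $ 4 + (v$1 * deriv_at d2 (x$1) 1 $ 2) * \<xi> x $ 4))
      + (of_nat 4 * (v$1 * \<eta> x) * \<rho> x ^ (4 - 1)) * \<eta> x)) (at x)"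
    unfolding \<Phi>_def[abs_def] \<eta>_def[of x] unfolding \<eta>_def[abs_def]
    by (intro has_derivative_diff has_derivative_mult has_derivative_power d2_M[OF assms(1) t]
        xi_has_derivative[OF assms(1)] rho_has_derivative[OF assms(1), unfolded \<eta>_def])
  moreover have "\<Phi> (x + r *\<^sub>R v) = \<Phi> x" if "x + r *\<^sub>R v \<in> M" for r
    using Phi_eq[OF that assms(1)] assms(2) by simp
  ultimately have "\<rho> x ^ 4 * ((d2 (x$1) $ 1 * deriv_at \<xi> x v $ 3 + (v$1 * deriv_at d2 (x$1) 1 $ 1) * \<xi> x $ 3)
      - (d2 (x$1) $ 2 * deriv_at \<xi> x v $ 4 + (v$1 * deriv_at d2 (x$1) 1 $ 2) * \<xi> x $ 4))
      + (of_nat 4 * (v$1 * \<eta> x) * \<rho> x ^ (4 - 1)) * \<eta> x = 0"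
    using assms(1) by (intro directional_derivative_cong[OF _ has_derivative_const[of "\<Phi> x"] open_M])
  then have "\<rho> x ^ 4 * (d2 (x$1) $ 1 * deriv_at \<xi> x v $ 3 - d2 (x$1) $ 2 * deriv_at \<xi> x v $ 4) = 0"
    using assms(2) by simp
  then have eq2: "d2 (x$1) $ 1 * deriv_at \<xi> x v $ 3 - d2 (x$1) $ 2 * deriv_at \<xi> x v $ 4 = 0"
    using rho_nonzero[OF assms(1)] by simp
  have "\<nu> x (deriv_at \<xi> x v) = 0"
    using xi_equiaffine[OF assms(1), of v] conormal_tangent[OF assms(1)] by auto
  then have eq1: "d1 (x$1) $ 1 * deriv_at \<xi> x v $ 3 - d1 (x$1) $ 2 * deriv_at \<xi> x v $ 4 = 0"
    using linear_0[OF linear_deriv_f, of "base x"] assms by (simp add: \<nu>_def xi_deriv_vertical mem_M)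
  \<comment> \<open>Cramer's rule: the system \<open>eq1\<close>, \<open>eq2\<close> has determinant
    - \<kappa>.\<close>
  have "\<kappa> (x$1) * deriv_at \<xi> x v $ 3 = 0" "\<kappa> (x$1) * deriv_at \<xi> x v $ 4 = 0"
    using eq1 eq2 unfolding \<kappa>_def by algebra+
  moreover have "\<kappa> (x$1) \<noteq> 0"
    using beta_positive[OF assms(1)] by (auto simp: \<beta>_def)
  ultimately show ?thesis
    using assms(1) by (simp add: vec_eq_iff forall_4 xi_deriv_vertical)
qed

text \<open>D\<xi> vanishes along the fibre, and D\<xi>(E) lies in the plane of the last two
  coordinates; a tangent vector whose image lies in that plane is a multiple of
  \<open>E\<close>.\<close>

lemma shape_operator_eq:
  assumes "x \<in> M"
  obtains \<sigma> where "\<And>v. shape_operator F \<xi> x v = (\<sigma> * v$1) *\<^sub>R E"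
proof -
  obtain X where X: "deriv_at \<xi> x E = deriv_at F x X"
    using xi_equiaffine[OF assms] by blast
  then have "X $ 2 = 0" "X $ 3 = 0"
    using xi_deriv_vertical[OF assms, of E] by (simp_all add: deriv_F[OF assms])
  then have X1: "X = X$1 *\<^sub>R E"
    by (simp add: vec_eq_iff forall_3)
  have "shape_operator F \<xi> x v = (- X$1 * v$1) *\<^sub>R E" for v
  proof -
    have lin: "linear (deriv_at \<xi> x)"
      by (rule has_derivative_linear[OF smooth_on_has_derivative[OF smooth_xi assms]])
    have "deriv_at \<xi> x v = deriv_at \<xi> x (v$1 *\<^sub>R E) + deriv_at \<xi> x (v - v$1 *\<^sub>R E)"
      by (simp flip: linear_add[OF lin])
    also have "\<dots> = v$1 *\<^sub>R deriv_at \<xi> x E"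
      using xi_deriv_fibre[OF assms, of "v - v$1 *\<^sub>R E"] by (simp add: linear_cmul[OF lin])
    also have "\<dots> = deriv_at F x (v$1 *\<^sub>R X) + 0 *\<^sub>R \<xi> x"
      by (simp add: X linear_cmul[OF linear_deriv_F[OF assms]])
    finally have "tangential_part F \<xi> x (deriv_at \<xi> x v) = v$1 *\<^sub>R X"
      using assms by (intro transversal_tangential_eqI linear_deriv_F inj_F xi_transversal)
    also have "\<dots> = (X$1 * v$1) *\<^sub>R E"
      by (subst X1) simp
    finally show ?thesis
      by (simp add: shape_operator_def)
  qed
  then show thesis
    by (rule that)
qed

text \<open>The second derivatives of F and the normal both lie in the plane of the last two
  coordinates, so the tangential part does too and is a multiple of \<open>E\<close>.\<close>

lemma induced_connection_eq:
  assumes "x \<in> M"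
  obtains a b where "\<And>v w. induced_connection F \<xi> (\<lambda>_. v) (\<lambda>_. w) x = (a * v$1 * w$1 + b * B x v w) *\<^sub>R E"
proof -
  define p where "p = d1 (x$1) $ 1"
  have "p \<noteq> 0"
    using alpha_nonzero[OF assms] by (auto simp: \<alpha>_def p_def)
  have "induced_connection F \<xi> (\<lambda>_. v) (\<lambda>_. w) x
      = (((d2 (x$1) $ 1 - \<beta> x * \<xi> x $ 4) / p) * v$1 * w$1 + (- \<xi> x $ 4 / \<rho> x) * B x v w) *\<^sub>R E" (is "_ = ?\<tau> *\<^sub>R E") for v w
    unfolding induced_connection_def F_second_derivative[OF assms]
  proof (rule transversal_tangential_eqI(2))
    define s u where "s = B x v w" and "u = v$1 * w$1"
    define c where "c = (p * s + \<kappa> (x$1) * u) / \<rho> x"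
    have c: "c * \<rho> x = p * s + \<kappa> (x$1) * u"
      using rho_nonzero[OF assms] by (simp add: c_def)
    \<comment> \<open>The fourth coordinate of the splitting fixes \<open>?\<tau>\<close>. The third
      one then follows, after multiplication by p, from the value of
      \<open>c * \<rho> x\<close>.\<close>
    have tau: "?\<tau> * p = u * d2 (x$1) $ 1 - c * \<xi> x $ 4"
      using \<open>p \<noteq> 0\<close> rho_nonzero[OF assms] unfolding c_def s_def u_def \<beta>_def by (simp add: field_simps)
    have "p * (?\<tau> * d1 (x$1) $ 2 + c * \<xi> x $ 3) = p * (s + u * d2 (x$1) $ 2)"
      using tau c unfolding rho_eq[OF assms] \<kappa>_def p_def by algebra
    then have "?\<tau> * d1 (x$1) $ 2 + c * \<xi> x $ 3 = s + u * d2 (x$1) $ 2"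
      using \<open>p \<noteq> 0\<close> by simp
    then show "vector [0, 0, B x v w + v$1 * w$1 * d2 (x$1) $ 2, v$1 * w$1 * d2 (x$1) $ 1]
        = deriv_at F x (?\<tau> *\<^sub>R E) + c *\<^sub>R \<xi> x"
      using tau linear_0[OF linear_deriv_f, of "base x"] assms
      by (simp add: deriv_F[OF assms] vec_eq_iff forall_4 xi_vertical linear_cmul[OF linear_base] mem_M
          s_def u_def p_def)
  qed (use assms linear_deriv_F inj_F xi_transversal in auto)
  then show thesis
    by (rule that)
qed

subsection \<open>The difference tensor\<close>

abbreviation T :: "real^3 \<Rightarrow> real^3 \<Rightarrow> real^3 \<Rightarrow> real^3 \<Rightarrow> real" where
  "T x u v w \<equiv> third_derivative f (base x) (base u) (base v) (base w)"

lemma third_commutes: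
  assumes "y \<in> N"
  shows "third_derivative f y u v w = third_derivative f y v u w" "third_derivative f y u v w = third_derivative f y u w v"
  using third_commute_left[OF open_N smooth_f assms] third_commute_right[OF open_N smooth_f assms] by auto

lemma third_bilinear:
  assumes "y \<in> N"
  shows "bilinear (third_derivative f y u)"
proof -
  have lin: "linear (\<lambda>u. third_derivative f y u v w)" for v w
    by (rule third_linear[OF smooth_f assms])
  have "linear (third_derivative f y u v)" for v
  proof -
    have "third_derivative f y u v = (\<lambda>w. third_derivative f y w u v)"
      using third_commutes[OF assms] by metis
    then show ?thesis
      using lin[of u v] by metis
  qed
  moreover have "linear (\<lambda>v. third_derivative f y u v w)" for w
  proof -
    have "(\<lambda>v. third_derivative f y u v w) = (\<lambda>v. third_derivative f y v u w)"
      using third_commutes[OF assms] by metis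
    then show ?thesis
      using lin[of u w] by metis
  qed
  ultimately show ?thesis
    by (simp add: bilinear_def)
qed

lemma B_linear:
  assumes "x \<in> M"
  shows "linear (\<lambda>v. B x v w)" "linear (\<lambda>w. B x v w)"
  using hess_bilinear[of "base x"] linear_compose[OF linear_base, of "\<lambda>v. hessian f (base x) v (base w)"]
    linear_compose[OF linear_base, of "hessian f (base x) (base v)"] assms
  by (auto simp: bilinear_def mem_M o_def)

lemma T_linear:
  assumes "x \<in> M"
  shows "linear (\<lambda>u. T x u v w)" "linear (\<lambda>v. T x u v w)" "linear (\<lambda>w. T x u v w)"
  using third_bilinear[of "base x" "base u"] third_linear[OF smooth_f, of "base x" "base v" "base w"] assms
    linear_compose[OF linear_base, of "\<lambda>u. third_derivative f (base x) u (base v) (base w)"]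
    linear_compose[OF linear_base, of "\<lambda>v. third_derivative f (base x) (base u) v (base w)"]
    linear_compose[OF linear_base, of "third_derivative f (base x) (base u) (base v)"]
  by (auto simp: bilinear_def mem_M o_def)

lemma T_commute:
  assumes "x \<in> M"
  shows "T x u v w = T x v u w" "T x u v w = T x u w v"
  using third_commutes[of "base x"] assms by (auto simp: mem_M)

lemma B_commute: "x \<in> M \<Longrightarrow> B x v w = B x w v"
  by (rule hess_commute) (simp add: mem_M)

lemmas B_simps = B_linear[THEN linear_add] B_linear[THEN linear_cmul] B_linear[THEN linear_diff] B_linear[THEN linear_0]
lemmas T_simps = T_linear[THEN linear_add] T_linear[THEN linear_cmul] T_linear[THEN linear_diff] T_linear[THEN linear_0]

text \<open>Obtained by differentiating det Hess f = 1; it is the source of the trace condition on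
  D^3 f.\<close>

lemma hessian_det_deriv:
  assumes "x \<in> M"
  defines "y \<equiv> base x"
  shows "third_derivative f y u (axis 1 1) (axis 1 1) * f22 y + f11 y * third_derivative f y u (axis 2 1) (axis 2 1)
    = 2 * f12 y * third_derivative f y u (axis 1 1) (axis 2 1)"
proof -
  have y: "y \<in> N"
    using assms by (simp add: mem_M)
  have der: "((\<lambda>y. f11 y * f22 y - f12 y * f12 y) has_derivative (\<lambda>u.
      (f11 y * third_derivative f y u (axis 2 1) (axis 2 1) + third_derivative f y u (axis 1 1) (axis 1 1) * f22 y)
      - (f12 y * third_derivative f y u (axis 1 1) (axis 2 1) + third_derivative f y u (axis 1 1) (axis 2 1) * f12 y))) (at y)"
    by (intro has_derivative_diff has_derivative_mult third_has_derivative[OF smooth_f y])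
  have zero: "((\<lambda>y. f11 y * f22 y - f12 y * f12 y) has_derivative (\<lambda>_. 0)) (at y)"
  proof (rule has_derivative_transform_within_open[OF has_derivative_const[of 1] open_N y])
    fix z assume "z \<in> N"
    \<comment> \<open>Every point of \<open>N\<close> lifts to a point of \<open>M\<close> over the
      t of x, so \<open>hessian_det\<close> holds on all of \<open>N\<close>.\<close>
    moreover have "base (vector [x$1, z$1, z$2]) = z"
      by (simp add: vec_eq_iff forall_2)
    ultimately show "1 = f11 z * f22 z - f12 z * f12 z"
      using hessian_det[of "vector [x$1, z$1, z$2]"] assms by (simp add: mem_M power2_eq_square)
  qed
  show ?thesis
    using fun_cong[OF has_derivative_unique[OF der zero], of u] by (simp add: algebra_simps)
qed

text \<open>Both coefficients are quotients by \<open>\<rho>\<close> of functions of t, and d\<rho>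
  is a multiple of dt.\<close>

lemma metric_coefficients_deriv:
  assumes "x \<in> M"
  obtains \<alpha>' \<beta>' where "(\<alpha> has_derivative (\<lambda>v. v$1 * \<alpha>')) (at x)" "(\<beta> has_derivative (\<lambda>v. v$1 * \<beta>')) (at x)"
proof -
  have t: "x$1 \<in> I"
    using assms by (simp add: mem_M)
  have quotient: "((\<lambda>q. g q / \<rho> q) has_derivative (\<lambda>v. v$1 * ((g' * \<rho> x - g x * \<eta> x) / (\<rho> x * \<rho> x)))) (at x)"
    if "(g has_derivative (\<lambda>v. v$1 * g')) (at x)" for g g'
    by (rule has_derivative_eq_rhs[OF has_derivative_divide'[OF that rho_has_derivative[OF assms] rho_nonzero[OF assms]]])
      (simp add: fun_eq_iff algebra_simps)
  let ?k = "(d1 (x$1) $ 1 * deriv_at d2 (x$1) 1 $ 2 + d2 (x$1) $ 1 * d2 (x$1) $ 2)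
     - (d1 (x$1) $ 2 * deriv_at d2 (x$1) 1 $ 1 + d2 (x$1) $ 2 * d2 (x$1) $ 1)"
  have "((\<lambda>q. d1 (q$1) $ 1 * d2 (q$1) $ 2 - d1 (q$1) $ 2 * d2 (q$1) $ 1) has_derivative (\<lambda>v.
     (d1 (x$1) $ 1 * (v$1 * deriv_at d2 (x$1) 1 $ 2) + (v$1 * d2 (x$1) $ 1) * d2 (x$1) $ 2)
     - (d1 (x$1) $ 2 * (v$1 * deriv_at d2 (x$1) 1 $ 1) + (v$1 * d2 (x$1) $ 2) * d2 (x$1) $ 1))) (at x)"
    by (intro has_derivative_diff has_derivative_mult d1_M[OF assms t] d2_M[OF assms t])
  then have "((\<lambda>q. \<kappa> (q$1)) has_derivative (\<lambda>v. v$1 * ?k)) (at x)"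
    unfolding \<kappa>_def by (rule has_derivative_eq_rhs) (simp add: fun_eq_iff algebra_simps)
  from quotient[OF d1_M[OF assms t, of 1]] quotient[OF this] show thesis
    unfolding \<alpha>_def[abs_def, symmetric] \<beta>_def[abs_def, symmetric] by (rule that)
qed

lemma metric_deriv:
  assumes "x \<in> M" and \<alpha>': "(\<alpha> has_derivative (\<lambda>v. v$1 * \<alpha>')) (at x)"
    and \<beta>': "(\<beta> has_derivative (\<lambda>v. v$1 * \<beta>')) (at x)"
  shows "deriv_at (\<lambda>q. affine_metric F \<xi> q v w) x u
    = u$1 * \<alpha>' * B x v w + \<alpha> x * T x u v w + u$1 * \<beta>' * v$1 * w$1"
proof -
  have y: "base x \<in> N"
    using assms by (simp add: mem_M)
  have "((\<lambda>q. \<alpha> q * B q v w + \<beta> q * (v$1 * w$1)) has_derivative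
      (\<lambda>u. (\<alpha> x * T x u v w + (u$1 * \<alpha>') * B x v w) + (u$1 * \<beta>') * (v$1 * w$1))) (at x)"
    by (intro has_derivative_add has_derivative_mult has_derivative_mult_left \<alpha>' \<beta>'
        has_derivative_base[OF third_has_derivative[OF smooth_f y]])
  from has_derivative_transform_within_open[OF this open_M assms(1), of "\<lambda>q. affine_metric F \<xi> q v w"]
  show ?thesis
    by (simp add: metric deriv_at_eq mult_ac)
qed

end

section \<open>Computations at one point in an adapted frame\<close>

locale adapted_frame = translation_hypersurface +
  fixes x :: "real^3" and X Y Z :: real
  assumes x: "x \<in> M" and adapted: "adapted x X Y Z"
begin

definition e2 :: "real^3" where "e2 = vector [0, X, 0]"
definition e3 :: "real^3" where "e3 = vector [0, Y, Z]"
definition x2 :: "real^3 \<Rightarrow> real" where "x2 v = \<alpha> x * B x v e2"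
definition x3 :: "real^3 \<Rightarrow> real" where "x3 v = \<alpha> x * B x v e3"
text \<open>The vector that represents the linear form \<open>T x v w\<close> in the affine
  metric.\<close>

definition cubic :: "real^3 \<Rightarrow> real^3 \<Rightarrow> real^3" where
  "cubic v w = T x v w e2 *\<^sub>R e2 + T x v w e3 *\<^sub>R e3"

lemma x2_x3_frame [simp]:
  "x2 E = 0" "x2 e2 = 1" "x2 e3 = 0" "x3 E = 0" "x3 e2 = 0" "x3 e3 = 1"
  using adapted B_commute[OF x, of e2 e3] B_simps(7,8)[OF x]
    bilinear_lzero[OF hess_bilinear, of "base x"] x
  by (simp_all add: x2_def x3_def adapted_def e2_def e3_def mem_M)

lemma e_nth [simp]: "e2 $ 1 = 0" "e3 $ 1 = 0"
  by (simp_all add: e2_def e3_def)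

lemma x_linear: "linear x2" "linear x3"
  unfolding x2_def[abs_def] x3_def[abs_def]
  by (auto intro!: linearI simp: B_simps[OF x] algebra_simps)

lemmas x_simps = x_linear[THEN linear_add] x_linear[THEN linear_cmul] x_linear[THEN linear_diff]

lemma expand: "v = v$1 *\<^sub>R E + x2 v *\<^sub>R e2 + x3 v *\<^sub>R e3"
proof -
  define t s where "t = v$3 / Z" and "s = (v$2 - t * Y) / X"
  have "X \<noteq> 0" "Z \<noteq> 0"
    using adapted by (auto simp: adapted_def)
  then have v: "v = v$1 *\<^sub>R E + s *\<^sub>R e2 + t *\<^sub>R e3"
    by (simp add: vec_eq_iff forall_3 e2_def e3_def t_def s_def)
  have "x2 v = s" "x3 v = t"
    by (subst v, simp add: x_simps)+
  with v show ?thesis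
    by simp
qed

lemma B_coords: "\<alpha> x * B x v w = x2 v * x2 w + x3 v * x3 w"
proof -
  have "B x v w = B x v (w$1 *\<^sub>R E + x2 w *\<^sub>R e2 + x3 w *\<^sub>R e3)"
    using expand[of w] by simp
  also have "\<dots> = x2 w * B x v e2 + x3 w * B x v e3"
    unfolding B_simps(2,4)[OF x] using B_commute[OF x, of v E] bilinear_rzero[OF hess_bilinear, of "base x"] x
    by (simp add: mem_M)
  finally show ?thesis
    by (simp add: x2_def x3_def algebra_simps)
qed

lemma T_expand: "T x u v w = x2 w * T x u v e2 + x3 w * T x u v e3"
proof -
  have "T x u v w = T x u v (w$1 *\<^sub>R E + x2 w *\<^sub>R e2 + x3 w *\<^sub>R e3)"
    using expand[of w] by simp
  also have "\<dots> = x2 w * T x u v e2 + x3 w * T x u v e3"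
    unfolding T_simps(3,6)[OF x] using bilinear_rzero[OF third_bilinear, of "base x"] x
    by (simp add: mem_M)
  finally show ?thesis .
qed

text \<open>By Jacobi's formula this trace is, up to the factor 1/\<alpha>, the logarithmic
  derivative of the constant det Hess f.\<close>

lemma apolar: "T x u e2 e2 + T x u e3 e3 = 0"
proof -
  have y: "base x \<in> N"
    using x by (simp add: mem_M)
  define y where "y = base x"
  define D11 D12 D22 where "D11 = third_derivative f y (base u) (axis 1 1) (axis 1 1)"
    and "D12 = third_derivative f y (base u) (axis 1 1) (axis 2 1)" and "D22 = third_derivative f y (base u) (axis 2 1) (axis 2 1)"
  have D: "third_derivative f y (base u) (vector [p, q]) (vector [r, s]) = p * r * D11 + (p * s + q * r) * D12 + q * s * D22" for p q r s
    unfolding D11_def D12_def D22_def y_def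
    by (subst bilinear_real2[OF third_bilinear[OF y] third_commutes(2)[OF y]]) simp
  define a b c where "a = \<alpha> x * f11 y" and "b = \<alpha> x * f12 y" and "c = \<alpha> x * f22 y"
  have "a * X * X = 1" "a * X * Y + b * X * Z = 0" "a * Y * Y + 2 * b * Y * Z + c * Z * Z = 1"
    using adapted hess_vector[OF y] unfolding adapted_def a_def b_def c_def y_def
    by (simp_all add: algebra_simps)
  \<comment> \<open>The frame inverts the Gram matrix: the matrix with entries X X + Y Y, Y Z, Z Z
    is the inverse of the one with entries a, b, c, whose determinant is 1 / (X X Z Z).\<close>
  then have "Z * Z = a * (X * X * Z * Z)" "Y * Z = - b * (X * X * Z * Z)" "X * X + Y * Y = c * (X * X * Z * Z)"
    by algebra+
  moreover have "D11 * c + a * D22 = 2 * b * D12"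
    using hessian_det_deriv[OF x, of "base u"] unfolding D11_def D12_def D22_def a_def b_def c_def y_def
    by algebra
  ultimately have "(X * X + Y * Y) * D11 + 2 * (Y * Z) * D12 + Z * Z * D22 = 0"
    by algebra
  then show ?thesis
    by (simp add: e2_def e3_def D[unfolded y_def] algebra_simps)
qed

text \<open>Symmetry and vanishing trace leave two free coefficients P and Q: the cubic form is the
  real part of (P + i Q) z^3 with z = x2 + i x3. The formula has the shape required by
  \<open>rotation_cubic_equivariant\<close>.\<close>

lemma cubic_coords: "cubic v w =
    (T x e2 e2 e2 * (x2 v * x2 w - x3 v * x3 w) - T x e3 e3 e3 * (x2 v * x3 w + x3 v * x2 w)) *\<^sub>R e2
  - (T x e2 e2 e2 * (x2 v * x3 w + x3 v * x2 w) + T x e3 e3 e3 * (x2 v * x2 w - x3 v * x3 w)) *\<^sub>R e3"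
proof -
  define P Q where "P = T x e2 e2 e2" and "Q = T x e3 e3 e3"
  have 1: "T x e3 e2 e2 = - Q" "T x e2 e3 e3 = - P"
    using apolar[of e3] apolar[of e2] by (simp_all add: P_def Q_def)
  then have 2: "T x e2 e2 e3 = - Q" "T x e2 e3 e2 = - Q" "T x e3 e3 e2 = - P" "T x e3 e2 e3 = - P"
    using T_commute[OF x] by metis+
  have "T x v w z = x2 w * T x v e2 z + x3 w * T x v e3 z" for v w z
    using T_expand[of v z w] T_commute(2)[OF x] by metis
  moreover have "T x v w z = x2 v * T x e2 w z + x3 v * T x e3 w z" for v w z
    using calculation[of w v z] T_commute(1)[OF x] by metis
  ultimately have "T x v w z = x2 v * (x2 w * T x e2 e2 z + x3 w * T x e2 e3 z)
      + x3 v * (x2 w * T x e3 e2 z + x3 w * T x e3 e3 z)" for z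
    by metis
  note T = this
  have "T x v w e2 = P * (x2 v * x2 w - x3 v * x3 w) - Q * (x2 v * x3 w + x3 v * x2 w)"
    "T x v w e3 = - (P * (x2 v * x3 w + x3 v * x2 w) + Q * (x2 v * x2 w - x3 v * x3 w))"
    unfolding T[of e2] T[of e3] 1 2 P_def[symmetric] Q_def[symmetric] by algebra+
  then show ?thesis
    unfolding cubic_def P_def[symmetric] Q_def[symmetric]
    by (simp only: scaleR_minus_left add_uminus_conv_diff)
qed

text \<open>The Koszul formula for \<alpha>(t) Hess f + \<beta>(t) dt^2, solved for the connection
  and then verified through uniqueness.\<close>

lemma christoffel_eq:
  assumes \<alpha>': "(\<alpha> has_derivative (\<lambda>v. v$1 * \<alpha>')) (at x)"
    and \<beta>': "(\<beta> has_derivative (\<lambda>v. v$1 * \<beta>')) (at x)"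
  shows "christoffel (affine_metric F \<xi>) x = (\<lambda>u v.
    ((\<beta>' / (2 * \<beta> x)) * u$1 * v$1 - (\<alpha>' / (2 * \<beta> x)) * B x u v) *\<^sub>R E
    + (\<alpha>' / (2 * \<alpha> x)) *\<^sub>R (u$1 *\<^sub>R (v - v$1 *\<^sub>R E) + v$1 *\<^sub>R (u - u$1 *\<^sub>R E))
    + (\<alpha> x / 2) *\<^sub>R cubic u v)" (is "_ = ?\<Gamma>")
proof (rule christoffel_eqI)
  have m: "affine_metric F \<xi> x v w = x2 v * x2 w + x3 v * x3 w + \<beta> x * v$1 * w$1" for v w
    by (simp add: metric[OF x] B_coords)
  show sym: "affine_metric F \<xi> x v w = affine_metric F \<xi> x w v" for v w
    by (simp add: m)
  have "linear (affine_metric F \<xi> x v)" for v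
    by (rule linearI) (simp_all add: m x_simps algebra_simps)
  then show "bilinear (affine_metric F \<xi> x)"
    by (simp add: bilinear_def sym[of _ w for w])
  show "v = 0" if "\<And>w. affine_metric F \<xi> x v w = 0" for v
    using that[of v] metric_positive[OF x, of v] by (auto simp: metric[OF x])
  show sym\<Gamma>: "?\<Gamma> u v = ?\<Gamma> v u" for u v
    by (simp add: cubic_def B_commute[OF x, of u v] T_commute(1)[OF x, of u v] add.commute mult.commute mult.left_commute)
  have "linear (?\<Gamma> u)" for u
    by (rule linearI)
      (simp_all add: cubic_def B_simps[OF x] T_simps[OF x] algebra_simps add_divide_distrib)
  then show "bilinear ?\<Gamma>"
    unfolding bilinear_def using sym\<Gamma> by (metis (no_types, lifting) ext)
  \<comment> \<open>Christoffel symbols of the first kind: half of u h(v,w) + v h(u,w) - w h(u,v).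
    Adding the same with v and w exchanged leaves u h(v,w).\<close>
  have "affine_metric F \<xi> x (?\<Gamma> u v) w = (\<beta>' * u$1 * v$1 * w$1 - \<alpha>' * B x u v * w$1
      + \<alpha>' * (u$1 * B x v w + v$1 * B x u w) + \<alpha> x * T x u v w) / 2" for u v w
  proof -
    have nth1: "?\<Gamma> u v $ 1 = (\<beta>' / (2 * \<beta> x)) * u$1 * v$1 - (\<alpha>' / (2 * \<beta> x)) * B x u v"
      by (simp add: cubic_def)
    have x23: "x2 (?\<Gamma> u v) = (\<alpha>' / (2 * \<alpha> x)) * (u$1 * x2 v + v$1 * x2 u) + \<alpha> x / 2 * T x u v e2"
      "x3 (?\<Gamma> u v) = (\<alpha>' / (2 * \<alpha> x)) * (u$1 * x3 v + v$1 * x3 u) + \<alpha> x / 2 * T x u v e3"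
      by (simp_all add: cubic_def x_simps)
    have "affine_metric F \<xi> x (?\<Gamma> u v) w = (\<alpha>' / (2 * \<alpha> x)) * (u$1 * (x2 v * x2 w + x3 v * x3 w)
        + v$1 * (x2 u * x2 w + x3 u * x3 w)) + \<alpha> x / 2 * (x2 w * T x u v e2 + x3 w * T x u v e3)
        + \<beta> x * ((\<beta>' / (2 * \<beta> x)) * u$1 * v$1 - (\<alpha>' / (2 * \<beta> x)) * B x u v) * w$1"
      unfolding m nth1 x23 by (simp add: algebra_simps)
    also have "\<dots> = (\<beta>' * u$1 * v$1 * w$1 - \<alpha>' * B x u v * w$1
      + \<alpha>' * (u$1 * B x v w + v$1 * B x u w) + \<alpha> x * T x u v w) / 2"
      unfolding B_coords[symmetric] T_expand[symmetric]
      using alpha_nonzero[OF x] beta_positive[OF x] by (simp add: field_simps)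
    finally show ?thesis .
  qed
  note half = this
  show "deriv_at (\<lambda>q. affine_metric F \<xi> q v w) x u
      = affine_metric F \<xi> x (?\<Gamma> u v) w + affine_metric F \<xi> x v (?\<Gamma> u w)" for u v w
    unfolding sym[of v] half metric_deriv[OF x \<alpha>' \<beta>']
    using B_commute[OF x, of v w] B_commute[OF x, of v u] T_commute(2)[OF x, of u v w]
    by (simp add: B_commute[OF x, of w v] field_simps)
qed

text \<open>All summands but the last are built from \<open>E\<close>, the first coordinate and
  \<open>B\<close>, hence commute with every rotation about \<open>E\<close>; only
  \<open>cubic\<close> restricts the angle.\<close>

lemma difference_tensor_eq:
  obtains a b c where "\<And>v w. difference_tensor F \<xi> x v w = (a * v$1 * w$1 + b * B x v w) *\<^sub>R E
    + c *\<^sub>R (v$1 *\<^sub>R (w - w$1 *\<^sub>R E) + w$1 *\<^sub>R (v - v$1 *\<^sub>R E)) - (\<alpha> x / 2) *\<^sub>R cubic v w"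
proof -
  obtain \<alpha>' \<beta>' where d: "(\<alpha> has_derivative (\<lambda>v. v$1 * \<alpha>')) (at x)" "(\<beta> has_derivative (\<lambda>v. v$1 * \<beta>')) (at x)"
    by (rule metric_coefficients_deriv[OF x])
  obtain a b where conn: "\<And>v w. induced_connection F \<xi> (\<lambda>_. v) (\<lambda>_. w) x = (a * v$1 * w$1 + b * B x v w) *\<^sub>R E"
    using induced_connection_eq[OF x] by blast
  show thesis
    by (rule that[of "a - \<beta>' / (2 * \<beta> x)" "b + \<alpha>' / (2 * \<beta> x)" "- \<alpha>' / (2 * \<alpha> x)"])
      (simp add: difference_tensor_def levi_civita_def conn christoffel_eq[OF d] algebra_simps)
qed

section \<open>Rotations of the frame\<close>

lemma frame_orthonormal: "orthonormal_frame (affine_metric F \<xi> x) [(1 / sqrt (\<beta> x)) *\<^sub>R E, e2, e3]"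
  using adapted_metric[OF x adapted] by (simp add: e2_def e3_def)

text \<open>With \<omega> = co + i si, \<open>double\<close> says that \<omega>^2 is the conjugate
  of \<omega>; combined with \<open>unit\<close> this means \<omega>^3 = 1.\<close>

context
  fixes A co si
  assumes lin: "linear A" and A: "A E = E" "A e2 = co *\<^sub>R e2 + si *\<^sub>R e3" "A e3 = - si *\<^sub>R e2 + co *\<^sub>R e3"
    and unit: "co\<^sup>2 + si\<^sup>2 = 1" and double: "co\<^sup>2 - si\<^sup>2 = co" "2 * co * si = - si"
begin

lemma rotate: "A v = v$1 *\<^sub>R E + x2 v *\<^sub>R (co *\<^sub>R e2 + si *\<^sub>R e3) + x3 v *\<^sub>R (- si *\<^sub>R e2 + co *\<^sub>R e3)"
proof -
  have "A v = A (v$1 *\<^sub>R E + x2 v *\<^sub>R e2 + x3 v *\<^sub>R e3)"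
    using expand[of v] by simp
  then show ?thesis
    by (simp add: linear_add[OF lin] linear_cmul[OF lin] A)
qed

lemma rotate_coords [simp]:
  "A v $ 1 = v$1" "x2 (A v) = co * x2 v - si * x3 v" "x3 (A v) = si * x2 v + co * x3 v"
  unfolding rotate by (simp_all add: x_simps)

lemma rotate_B: "B x (A v) (A w) = B x v w"
proof -
  have "\<alpha> x * B x (A v) (A w) = (co\<^sup>2 + si\<^sup>2) * (x2 v * x2 w + x3 v * x3 w)"
    unfolding B_coords rotate_coords by algebra
  then show ?thesis
    using alpha_nonzero[OF x] by (simp add: unit flip: B_coords)
qed

lemma rotate_cubic: "cubic (A v) (A w) = A (cubic v w)"
  by (rule rotation_cubic_equivariant[where x = x2 and y = x3 and G = cubic, OF lin A(2,3) rotate_coords(2,3) double cubic_coords])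

lemma rotate_shape: "shape_operator F \<xi> x (A v) = A (shape_operator F \<xi> x v)"
proof -
  obtain \<sigma> where "\<And>v. shape_operator F \<xi> x v = (\<sigma> * v$1) *\<^sub>R E"
    using shape_operator_eq[OF x] by blast
  then show ?thesis
    by (simp add: linear_cmul[OF lin] A)
qed

lemma rotate_difference_tensor:
  "difference_tensor F \<xi> x (A v) (A w) = A (difference_tensor F \<xi> x v w)"
proof -
  obtain a b c where "\<And>v w. difference_tensor F \<xi> x v w = (a * v$1 * w$1 + b * B x v w) *\<^sub>R E
    + c *\<^sub>R (v$1 *\<^sub>R (w - w$1 *\<^sub>R E) + w$1 *\<^sub>R (v - v$1 *\<^sub>R E)) - (\<alpha> x / 2) *\<^sub>R cubic v w"
    using difference_tensor_eq by blast
  then show ?thesis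
    by (simp add: rotate_B rotate_cubic linear_add[OF lin] linear_diff[OF lin] linear_cmul[OF lin] A)
qed

end

end

text \<open>Since 3 \<theta> is a multiple of 2 pi, the angles 2 \<theta> and - \<theta> agree
  modulo 2 pi; the double angle formulas finish.\<close>

lemma cos_sin_third_turn:
  fixes k :: int
  defines "\<theta> \<equiv> of_int k * (2 * pi / 3)"
  shows "(cos \<theta>)\<^sup>2 - (sin \<theta>)\<^sup>2 = cos \<theta>" "2 * cos \<theta> * sin \<theta> = - sin \<theta>"
proof -
  have "2 * \<theta> = 2 * pi * of_int k - \<theta>"
    by (simp add: \<theta>_def)
  then have "cos (2 * \<theta>) = cos (2 * pi * of_int k - \<theta>)" "sin (2 * \<theta>) = sin (2 * pi * of_int k - \<theta>)"
    by (simp_all only:)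
  then have "cos (2 * \<theta>) = cos \<theta>" "sin (2 * \<theta>) = - sin \<theta>"
    unfolding cos_diff sin_diff cos_int_2pin sin_int_2pin by simp_all
  then show "(cos \<theta>)\<^sup>2 - (sin \<theta>)\<^sup>2 = cos \<theta>" "2 * cos \<theta> * sin \<theta> = - sin \<theta>"
    unfolding cos_double sin_double by (simp_all add: mult_ac)
qed

section \<open>The pointwise symmetry\<close>

context translation_hypersurface
begin

lemma Z3_symmetry: "pointwise_Z3_symmetry M F \<xi>"
  unfolding pointwise_Z3_symmetry_def pointwise_symmetry_def
proof
  fix x assume x: "x \<in> M"
  obtain X Y Z where "adapted x X Y Z"
    using adapted_exists[OF x] .
  then interpret adapted_frame N f I \<gamma> \<xi> F M x X Y Z
    by unfold_locales (use x in \<open>auto simp: F_def M_def\<close>)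
  let ?e1 = "(1 / sqrt (\<beta> x)) *\<^sub>R E"
  have "(\<forall>v w. difference_tensor F \<xi> x (A v) (A w) = A (difference_tensor F \<xi> x v w)) \<and>
      (\<forall>v. shape_operator F \<xi> x (A v) = A (shape_operator F \<xi> x v))"
    if A: "A \<in> rotations (affine_metric F \<xi> x) ?e1 e2 e3 {of_int k * (2 * pi / 3) | k. True}" for A
  proof -
    obtain k where lin: "linear A" and A1: "A ?e1 = ?e1"
      and A23: "A e2 = cos (of_int k * (2 * pi / 3)) *\<^sub>R e2 + sin (of_int k * (2 * pi / 3)) *\<^sub>R e3"
        "A e3 = - sin (of_int k * (2 * pi / 3)) *\<^sub>R e2 + cos (of_int k * (2 * pi / 3)) *\<^sub>R e3"
      using A unfolding rotations_def orientation_preserving_isometries_def by blast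
    \<comment> \<open>The axis of the orthonormal frame is \<open>E\<close> scaled by a nonzero
      factor, which linearity cancels.\<close>
    have AE: "A E = E"
      using A1 beta_positive[OF x] by (simp add: linear_cmul[OF lin])
    note facts = lin AE A23 sin_cos_squared_add2 cos_sin_third_turn
    show ?thesis
      using rotate_difference_tensor[OF facts] rotate_shape[OF facts] by blast
  qed
  then show "\<exists>e1 e2 e3. orthonormal_frame (affine_metric F \<xi> x) [e1, e2, e3] \<and>
        (\<forall>A\<in>rotations (affine_metric F \<xi> x) e1 e2 e3 {of_int k * (2 * pi / 3) | k. True}.
           (\<forall>v w. difference_tensor F \<xi> x (A v) (A w) = A (difference_tensor F \<xi> x v w)) \<and>
           (\<forall>v. shape_operator F \<xi> x (A v) = A (shape_operator F \<xi> x v)))"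
    using frame_orthonormal by blast
qed

end

theorem theorem4p6:
  fixes N :: "(real^2) set" and f :: "real^2 \<Rightarrow> real"
    and I :: "real set" and \<gamma> :: "real \<Rightarrow> real^2"
    and \<psi> :: "real^2 \<Rightarrow> real^3" and F \<xi> :: "real^3 \<Rightarrow> real^4" and M :: "(real^3) set"
  defines "\<psi> \<equiv> \<lambda>x. vector [x$1, x$2, f x]"
    and "M \<equiv> {x. x$1 \<in> I \<and> vector [x$2, x$3] \<in> N}"
    and "F \<equiv> \<lambda>x. vector [x$2, x$3, f (vector [x$2, x$3]) + \<gamma> (x$1) $ 2, \<gamma> (x$1) $ 1]"
  assumes "improper_affine_sphere N \<psi> (vector [0, 0, 1])"
    and "is_interval I" and "open I" and "smooth_on I \<gamma>"
    and "positive_definite_hypersurface M F \<xi>"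
  shows "pointwise_Z3_symmetry M F \<xi> \<or> pointwise_SO2_symmetry M F \<xi>"
proof -
  interpret translation_hypersurface N f I \<gamma> \<xi> F M
    using assms(4,7,8) unfolding \<psi>_def
    by unfold_locales (simp_all add: M_def F_def base_def)
  show ?thesis
    using Z3_symmetry ..
qed

end
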